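(* Let $\underline{\kappa}<\overline{\kappa}$ be the two real solutions in $(0,e)$ of $\kappa(1-\log\kappa)=\tfrac12$ (so $0<\underline{\kappa}<1<\overline{\kappa}<e$). For $x\ge e$ let $\underline{m}=\lfloor\underline{\kappa}\log(x)\rfloor$, $\overline{m}=\lfloor\overline{\kappa}\log(x)\rfloor$, $$li_{0}(x)=\frac{x}{\log(x)}\sum_{k=0}^{\underline{m}-1}\frac{k!}{\log^{k}(x)},\qquad li_{1}(x)=\frac{x}{\log(x)}\sum_{k=0}^{\overline{m}}\frac{k!}{\log^{k}(x)}.$$ If $li_{0}(x)\le\pi(x)\le li_{1}(x)$ for all $x\ge e$, then the Riemann Hypothesis holds.
   Context: $\log$ is the natural logarithm; empty sums are $0$; $\pi(x)$ denotes the number of primes $\le x$. The Riemann Hypothesis asserts that all nontrivial zeros of the Riemann zeta function have real part $1/2$; equivalently, $|\pi(x)-li(x)|=O(x^{1/2+\epsilon})$ for every $\epsilon>0$, where $li(x)=\int_0^x\frac{dt}{\log t}$. *)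

theory Defs
  imports
    "HOL-Complex_Analysis.Complex_Analysis"
    "HOL-Computational_Algebra.Primes"
begin

definition primes_pi :: "real \<Rightarrow> nat" where
  "primes_pi x = card {p::nat. prime p \<and> real p \<le> x}"

(* The unique analytic continuation of the Dirichlet series to the plane without 1
   (unique by the identity theorem). The value at the pole is the dummy 0, so that the
   description determines a total function. *)
definition riemann_zeta :: "complex \<Rightarrow> complex" where
  "riemann_zeta = (THE f. f holomorphic_on (- {1})
      \<and> (\<forall>s. Re s > 1 \<longrightarrow> f s = (\<Sum>n. 1 / of_nat (Suc n) powr s))
      \<and> f 1 = 0)"

(* The pole s = 1 is excluded because of the dummy value there; the trivial zeros are the
   negative even integers. *)
definition riemann_hypothesis :: bool where
  "riemann_hypothesis \<longleftrightarrow>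
     (\<forall>s. s \<noteq> 1 \<and> riemann_zeta s = 0 \<and> (\<nexists>n::nat. n \<ge> 1 \<and> s = - 2 * of_nat n)
        \<longrightarrow> Re s = 1 / 2)"

(* The parameter is the constant kappa. For x >= e the floor is a nonnegative integer, so
   nat does not truncate. Summing over k < m renders the sum from 0 to m - 1, which is
   empty if m = 0. *)
definition li0 :: "real \<Rightarrow> real \<Rightarrow> real" where
  "li0 \<kappa> x = x / ln x * (\<Sum>k<nat \<lfloor>\<kappa> * ln x\<rfloor>. fact k / ln x ^ k)"

definition li1 :: "real \<Rightarrow> real \<Rightarrow> real" where
  "li1 \<kappa> x = x / ln x * (\<Sum>k\<le>nat \<lfloor>\<kappa> * ln x\<rfloor>. fact k / ln x ^ k)"

end

theory Submission
  imports Defs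
begin

text \<open>
  The truncated expansions differ from an antiderivative of \<^term>\<open>exp t / t\<close> (where
  \<open>x = exp t\<close>) by \<open>O(t\<^sup>2 exp (t/2))\<close>: between the points where a term is added the
  difference has derivative \<open>m! exp t / t^(m+1)\<close> with \<open>m\<close> the integer part of \<open>\<kappa> t\<close>, at
  those points it jumps by a quantity of the same size, and Stirling together with
  \<open>\<kappa> (1 - ln \<kappa>) = 1/2\<close> makes this \<open>O(t exp (t/2))\<close>. So the hypothesis is a square-root error term in
  the prime number theorem. The Laplace transform of that error term is holomorphic on
  \<open>Re s > 1/2\<close>, and the Euler product turns it into an identity
  \<open>(s - 1) \<zeta>(s) W(s) = exp (K(s))\<close> with \<open>W\<close> and \<open>K\<close> holomorphic there; hence \<open>\<zeta>\<close> has no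
  zero with \<open>Re s > 1/2\<close>. The functional equation excludes nontrivial zeros with
  \<open>Re s < 1/2\<close>; it is derived from the partial fraction expansion of \<open>1 / (exp t - 1)\<close>
  integrated against \<open>t powr (s - 1)\<close> for real \<open>s\<close> between \<open>-1\<close> and \<open>0\<close>.
\<close>

section \<open>Holomorphic integrals and analytic continuation\<close>

text \<open>The terms \<open>fact k / t ^ k\<close> fall to about \<open>exp (- t)\<close> near
  \<open>k = t\<close> and then grow. The equation for \<kappa> marks the two indices
  \<open>\<kappa> * t\<close>, one on each side of this minimum, where a term is
  \<open>exp (- t / 2)\<close> up to powers of \<open>t\<close>. For \<open>s > 1\<close> the sum of
  \<open>p powr (- s)\<close> over primes is \<open>s\<close> times the Laplace transform of the
  prime count. Its main part gives \<open>- ln (s - 1)\<close> plus an entire function of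
  \<open>s\<close>; the first matches the pole of zeta. The logarithm of zeta differs from the prime
  sum by the higher prime powers, harmless for \<open>Re s > 1/2\<close>. Working with the product
  \<open>W\<close> avoids choosing a logarithm of zeta where zeta might still vanish. Zeta is given
  by a definite description, so its existence, uniqueness and functional equation must precede any
  statement on zeros. The Mellin formulas are proved at real arguments, where the integrands are
  nonnegative and sums may be exchanged with integrals; the identity theorem then carries them over.
  Between \<open>-1\<close> and \<open>0\<close> the kernel minus the first two terms of its
  expansion at \<open>0\<close> has a convergent Mellin integral over the whole half-line.\<close>

lemma holomorphic_on_lebesgue_integral:
  fixes f :: "complex \<Rightarrow> 'a \<Rightarrow> complex"
  assumes "open S"
    and holo: "\<And>x. x \<in> space M \<Longrightarrow> (\<lambda>s. f s x) holomorphic_on S"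
    and meas: "\<And>s. s \<in> S \<Longrightarrow> f s \<in> borel_measurable M"
    and dom: "\<And>s. s \<in> S \<Longrightarrow> \<exists>r>0. \<exists>g. cball s r \<subseteq> S \<and> integrable M g \<and>
                (\<forall>w\<in>cball s r. \<forall>x\<in>space M. norm (f w x) \<le> g x)"
  shows "(\<lambda>s. \<integral>x. f s x \<partial>M) holomorphic_on S"
  unfolding holomorphic_on_open[OF \<open>open S\<close>]
proof
  fix s assume s: "s \<in> S"
  then obtain r g where r: "r > 0" and sub: "cball s r \<subseteq> S" and g: "integrable M g"
    and le: "\<And>w x. w \<in> cball s r \<Longrightarrow> x \<in> space M \<Longrightarrow> norm (f w x) \<le> g x"
    using dom by blast
  define D where "D x = deriv (\<lambda>w. f w x) s" for x
  \<comment> \<open>Only \<open>f\<close> itself is dominated. Cauchy's inequality on discs of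
    radius \<open>r / 2\<close> inside \<open>cball s r\<close> bounds the derivative, and the
    resulting Lipschitz bound dominates the difference quotients.\<close>
  have lip: "norm (f (s + h) x - f s x) \<le> (2 / r * g x) * norm h"
    if h: "norm h < r / 2" and x: "x \<in> space M" for h x
  proof -
    have hol: "(\<lambda>w. f w x) holomorphic_on cball s r"
      by (rule holomorphic_on_subset[OF holo[OF x] sub])
    have "norm (deriv (\<lambda>w. f w x) z) \<le> 2 / r * g x" if z: "z \<in> ball s (r/2)" for z
    proof -
      have zs: "cball z (r/2) \<subseteq> cball s r"
        using z by (auto simp: cball_subset_cball_iff dist_commute)
      have "norm ((deriv ^^ 1) (\<lambda>w. f w x) z) \<le> fact 1 * g x / (r/2)^1"
      proof (rule Cauchy_inequality)
        show "(\<lambda>w. f w x) holomorphic_on ball z (r/2)"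
          using hol zs by (meson ball_subset_cball holomorphic_on_subset)
        show "continuous_on (cball z (r/2)) (\<lambda>w. f w x)"
          using hol zs by (meson holomorphic_on_imp_continuous_on holomorphic_on_subset)
        show "norm (f w x) \<le> g x" if "norm (z - w) = r/2" for w
          using that zs x by (intro le) (auto simp: dist_norm)
      qed (use r in auto)
      thus ?thesis by (simp add: mult.commute)
    qed
    moreover have "((\<lambda>w. f w x) has_field_derivative deriv (\<lambda>w. f w x) z) (at z within ball s (r/2))"
      if "z \<in> ball s (r/2)" for z
    proof (rule holomorphic_derivI[where S = "ball s r"])
      show "(\<lambda>w. f w x) holomorphic_on ball s r"
        using hol by (meson ball_subset_cball holomorphic_on_subset)
    qed (use that r in auto)
    ultimately have "norm (f (s + h) x - f s x) \<le> 2 / r * g x * norm (s + h - s)"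
      by (intro field_differentiable_bound[where S = "ball s (r/2)"
             and f' = "\<lambda>z. deriv (\<lambda>w. f w x) z"])
         (use h r in \<open>auto simp: dist_norm\<close>)
    thus ?thesis by simp
  qed
  have int: "integrable M (f w)" if "w \<in> cball s r" for w
  proof (rule Bochner_Integration.integrable_bound[OF g])
    show "f w \<in> borel_measurable M" using meas sub that by blast
    show "AE x in M. norm (f w x) \<le> norm (g x)"
      using le[OF that] by (intro AE_I2) (simp add: order_trans[OF _ abs_ge_self])
  qed
  have der: "((\<lambda>w. f w x) has_field_derivative D x) (at s)" if "x \<in> space M" for x
    unfolding D_def by (rule holomorphic_derivI[OF holo[OF that] \<open>open S\<close> s])
  have "((\<lambda>s. \<integral>x. f s x \<partial>M) has_field_derivative (\<integral>x. D x \<partial>M)) (at s)"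
    unfolding DERIV_def tendsto_at_iff_sequentially comp_def
  proof safe
    fix X :: "nat \<Rightarrow> complex"
    assume X0: "\<forall>i. X i \<in> UNIV - {0}" and X: "X \<longlonglongrightarrow> 0"
    have "eventually (\<lambda>n. dist (X n) 0 < r/2) sequentially"
      using X r by (intro tendstoD) auto
    then obtain N where N: "norm (X n) < r/2" if "n \<ge> N" for n
      by (auto simp: eventually_at_top_linorder)
    \<comment> \<open>Skipping \<open>N\<close> terms puts every \<open>s + X (n + N)\<close> into
      the half-radius disc where the Lipschitz bound holds.\<close>
    define q where "q n x = (f (s + X (n + N)) x - f s x) / X (n + N)" for n x
    have inb: "s + X (n + N) \<in> cball s r" "s \<in> cball s r" for n
      using N[of "n + N"] r by (auto simp: dist_norm)
    have qm: "q n \<in> borel_measurable M" for n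
      unfolding q_def using inb sub s by (intro borel_measurable_divide borel_measurable_diff meas) auto
    have qlim: "(\<lambda>n. q n x) \<longlonglongrightarrow> D x" if "x \<in> space M" for x
    proof -
      have "(\<lambda>n. (f (s + X n) x - f s x) / X n) \<longlonglongrightarrow> D x"
        using der[OF that] X0 X unfolding DERIV_def tendsto_at_iff_sequentially comp_def by auto
      thus ?thesis unfolding q_def by (rule LIMSEQ_ignore_initial_segment)
    qed
    have "(\<lambda>n. \<integral>x. q n x \<partial>M) \<longlonglongrightarrow> (\<integral>x. D x \<partial>M)"
    proof (rule integral_dominated_convergence)
      show "D \<in> borel_measurable M" using qlim by (rule borel_measurable_LIMSEQ_metric[OF qm])
      show "integrable M (\<lambda>x. 2 / r * g x)" using g by simp
      show "AE x in M. (\<lambda>n. q n x) \<longlonglongrightarrow> D x" using qlim by simp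
      show "AE x in M. norm (q n x) \<le> 2 / r * g x" for n
      proof (rule AE_I2)
        fix x assume x: "x \<in> space M"
        have "norm (X (n + N)) > 0" using X0 by simp
        moreover have "norm (f (s + X (n + N)) x - f s x) \<le> (2 / r * g x) * norm (X (n + N))"
          by (rule lip) (use N x in auto)
        ultimately show "norm (q n x) \<le> 2 / r * g x"
          unfolding q_def norm_divide by (subst pos_divide_le_eq)
      qed
    qed (use qm in auto)
    moreover have "(\<integral>x. q n x \<partial>M) = ((\<integral>x. f (s + X (n + N)) x \<partial>M) - (\<integral>x. f s x \<partial>M)) / X (n + N)" for n
      unfolding q_def
      by (simp only: Bochner_Integration.integral_diff[OF int[OF inb(1)] int[OF inb(2)]]
          integral_divide_zero)
    ultimately have "(\<lambda>n. ((\<integral>x. f (s + X (n + N)) x \<partial>M) - (\<integral>x. f s x \<partial>M)) / X (n + N))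
        \<longlonglongrightarrow> (\<integral>x. D x \<partial>M)"
      by (simp only:)
    thus "(\<lambda>n. ((\<integral>x. f (s + X n) x \<partial>M) - (\<integral>x. f s x \<partial>M)) / X n) \<longlonglongrightarrow> (\<integral>x. D x \<partial>M)"
      by (rule LIMSEQ_offset)
  qed
  thus "\<exists>f'. ((\<lambda>s. \<integral>x. f s x \<partial>M) has_field_derivative f') (at s)" by blast
qed

text \<open>Serves three transforms: Mellin (\<open>L = ln\<close>), Dirichlet series
  (\<open>L = - ln\<close> on a counting measure) and Laplace (\<open>L t = - t\<close>). Near
  \<open>s\<close>, \<open>exp (Re w * L x)\<close> is at most the sum of its values at the real
  parts \<open>Re s - r\<close> and \<open>Re s + r\<close>, whatever the sign of
  \<open>L x\<close>.\<close>

lemma holomorphic_on_exp_transform: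
  fixes h :: "'a \<Rightarrow> complex" and L :: "'a \<Rightarrow> real"
  assumes T: "open T" and [measurable]: "h \<in> borel_measurable M" "L \<in> borel_measurable M"
    and int: "\<And>\<sigma>. \<sigma> \<in> T \<Longrightarrow> integrable M (\<lambda>x. norm (h x) * exp (\<sigma> * L x))"
  shows "(\<lambda>s. \<integral>x. h x * exp (s * of_real (L x)) \<partial>M) holomorphic_on {s. Re s \<in> T}"
proof (rule holomorphic_on_lebesgue_integral)
  show "open {s. Re s \<in> T}"
    using open_vimage[OF T, of Re] continuous_on_Re[OF continuous_on_id] by (simp add: vimage_def)
next
  fix s assume s: "s \<in> {s. Re s \<in> T}"
  then obtain r where r: "r > 0" "cball (Re s) r \<subseteq> T"
    using open_contains_cball[of T] T by auto
  have R: "Re w \<in> cball (Re s) r" if "w \<in> cball s r" for w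
    using that abs_Re_le_cmod[of "s - w"] by (auto simp: dist_norm)
  define g where "g x = norm (h x) * exp ((Re s - r) * L x) + norm (h x) * exp ((Re s + r) * L x)" for x
  have "integrable M g" unfolding g_def
    using r by (intro Bochner_Integration.integrable_add int) (auto simp: subset_iff dist_real_def)
  moreover have "norm (h x * exp (w * of_real (L x))) \<le> g x" if w: "w \<in> cball s r" for w x
  proof -
    have "\<bar>Re s - Re w\<bar> \<le> r" using R[OF w] by (simp add: dist_real_def)
    hence "Re s - r \<le> Re w" "Re w \<le> Re s + r" by linarith+
    hence "Re w * L x \<le> (Re s - r) * L x \<or> Re w * L x \<le> (Re s + r) * L x"
      by (metis linorder_linear mult_right_mono mult_right_mono_neg)
    hence "exp (Re w * L x) \<le> exp ((Re s - r) * L x) \<or> exp (Re w * L x) \<le> exp ((Re s + r) * L x)"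
      by simp
    hence "exp (Re w * L x) \<le> exp ((Re s - r) * L x) + exp ((Re s + r) * L x)"
      by (metis add.commute add_increasing exp_ge_zero)
    hence "norm (h x) * exp (Re w * L x) \<le> norm (h x) * (exp ((Re s - r) * L x) + exp ((Re s + r) * L x))"
      by (rule mult_left_mono) simp
    thus ?thesis
      unfolding g_def norm_mult norm_exp_eq_Re by (simp add: distrib_left)
  qed
  moreover have "cball s r \<subseteq> {s. Re s \<in> T}" using R r by blast
  ultimately show "\<exists>r>0. \<exists>g. cball s r \<subseteq> {s. Re s \<in> T} \<and> integrable M g \<and>
      (\<forall>w\<in>cball s r. \<forall>x\<in>space M. norm (h x * exp (w * of_real (L x))) \<le> g x)"
    using r by (intro exI[of _ r] conjI exI[of _ g]) auto
next
  show "(\<lambda>x. h x * exp (s * of_real (L x))) \<in> borel_measurable M" for s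
    by measurable
qed (intro holomorphic_intros)

text \<open>A real interval accumulates at its midpoint, so agreement there forces agreement on the
  connected set. This lifts identities proved at real arguments.\<close>

lemma analytic_continuation_real_interval:
  fixes f g :: "complex \<Rightarrow> complex" and a b :: real
  assumes "f holomorphic_on S" "g holomorphic_on S" "open S" "connected S" "a < b"
    and sub: "\<And>x. a < x \<Longrightarrow> x < b \<Longrightarrow> of_real x \<in> S"
    and eq: "\<And>x. a < x \<Longrightarrow> x < b \<Longrightarrow> f (of_real x) = g (of_real x)"
    and z: "z \<in> S"
  shows "f z = g z"
proof -
  define m where "m = (a + b) / 2"
  have m: "a < m" "m < b" using \<open>a < b\<close> by (auto simp: m_def)
  have "complex_of_real m islimpt (of_real ` {a<..<b})"
    unfolding islimpt_approachable
  proof (intro allI impI)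
    fix e :: real assume e: "e > 0"
    obtain d where d: "d > 0" "d < e" "d < b - m"
      using dense[of 0 "min e (b - m)"] e m by auto
    define x where "x = m + d"
    have x: "x > m" "x < b" "x < m + e" unfolding x_def using d by auto
    have "dist (complex_of_real x) (of_real m) = \<bar>x - m\<bar>"
      by (simp only: dist_of_real dist_real_def)
    hence "dist (complex_of_real x) (of_real m) < e" using x by simp
    moreover have "x \<in> {a<..<b}" "complex_of_real x \<noteq> of_real m" using x m by auto
    ultimately show "\<exists>x'\<in>of_real ` {a<..<b}. x' \<noteq> complex_of_real m \<and> dist x' (of_real m) < e"
      by blast
  qed
  hence "f z - g z = 0"
  proof (rule analytic_continuation[where f = "\<lambda>z. f z - g z", OF _ \<open>open S\<close> \<open>connected S\<close>, rotated 3])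
    show "(\<lambda>z. f z - g z) holomorphic_on S" using assms(1,2) by (rule holomorphic_on_diff)
    show "complex_of_real ` {a<..<b} \<subseteq> S" using sub by auto
    show "complex_of_real m \<in> S" using sub m by simp
    show "f w - g w = 0" if "w \<in> complex_of_real ` {a<..<b}" for w using that eq by auto
  qed (rule z)
  thus ?thesis by simp
qed

section \<open>Mellin transforms of the Bose kernel\<close>

text \<open>Euler's product for the sine, taken at the imaginary argument i t / 2: the factors are
  real there, and taking imaginary parts removes the common i.\<close>

lemma sinh_product_tendsto:
  fixes t :: real
  shows "(\<lambda>n. t / 2 * (\<Prod>k<n. 1 + t\<^sup>2 / (2 * pi * real (Suc k))\<^sup>2)) \<longlonglongrightarrow> sinh (t / 2)"
proof -
  define z where "z = \<i> * of_real (t / (2 * pi))"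
  have piz: "of_real pi * z = \<i> * of_real (t / 2)" by (simp add: z_def)
  have z2: "z\<^sup>2 = - of_real ((t / (2 * pi))\<^sup>2)" by (simp add: z_def power_mult_distrib power_divide)
  have fac: "1 - z\<^sup>2 / of_nat (Suc k) ^ 2 = of_real (1 + t\<^sup>2 / (2 * pi * real (Suc k))\<^sup>2)" for k
    unfolding z2 by (simp add: power_divide power_mult_distrib)
  have eq: "(\<Prod>k=1..n. 1 - z\<^sup>2 / of_nat k ^ 2) = of_real (\<Prod>k<n. 1 + t\<^sup>2 / (2 * pi * real (Suc k))\<^sup>2)" for n
  proof -
    have "(\<Prod>k=1..n. 1 - z\<^sup>2 / of_nat k ^ 2) = (\<Prod>k<n. 1 - z\<^sup>2 / of_nat (Suc k) ^ 2)"
      by (rule prod.reindex_bij_witness[of _ Suc "\<lambda>k. k - 1"]) auto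
    thus ?thesis unfolding fac by simp
  qed
  have sn: "sin (of_real pi * z) = \<i> * of_real (sinh (t / 2))"
    unfolding piz sin_i_times sinh_field_def exp_minus exp_of_real by simp
  have "(\<lambda>n. Im (of_real pi * z * (\<Prod>k=1..n. 1 - z\<^sup>2 / of_nat k ^ 2))) \<longlonglongrightarrow> Im (\<i> * of_real (sinh (t / 2)))"
    unfolding sn[symmetric] by (intro tendsto_Im sin_product_formula_complex)
  moreover have "Im (\<i> * complex_of_real x * complex_of_real y) = x * y" for x y by simp
  moreover have "Im (\<i> * complex_of_real x) = x" for x by simp
  ultimately show ?thesis unfolding piz eq by (simp only:)
qed

lemma inverse_square_pi_summable: "summable (\<lambda>n. 1 / (2 * pi * real (Suc n))\<^sup>2)"
proof -
  have "summable (\<lambda>n. inverse (real (Suc n) ^ 2))"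
    by (subst summable_Suc_iff) (rule inverse_power_summable, simp)
  hence "summable (\<lambda>n. 1 / (2 * pi)\<^sup>2 * inverse (real (Suc n) ^ 2))" by (rule summable_mult)
  moreover have "1 / (2 * pi * real (Suc n))\<^sup>2 = 1 / (2 * pi)\<^sup>2 * inverse (real (Suc n) ^ 2)" for n
    by (simp only: power_mult_distrib divide_inverse inverse_mult_distrib mult_1_left)
  ultimately show ?thesis by simp
qed

text \<open>The terms \<open>1 / t\<close> and \<open>- 1 / 2\<close> open the Laurent expansion of
  \<open>1 / (exp t - 1)\<close> at \<open>0\<close>. Without them the kernel is O(t) at
  \<open>0\<close> and tends to \<open>1 / 2\<close> at infinity.\<close>

definition bose_remainder :: "real \<Rightarrow> real" where
  "bose_remainder t = 1 / (exp t - 1) - 1 / t + 1 / 2"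

text \<open>Logarithmic derivative of the product for \<open>sinh (t / 2) / (t / 2)\<close>,
  combined with \<open>coth (t / 2) / 2 = 1 / (exp t - 1) + 1 / 2\<close>.\<close>

lemma bose_remainder_sums:
  assumes t: "t > 0"
  shows "(\<lambda>n. 2 * t / (t\<^sup>2 + (2 * pi * real (Suc n))\<^sup>2)) sums bose_remainder t"
proof -
  define a where "a n = 2 * pi * real (Suc n)" for n
  have a: "a n > 0" for n by (simp add: a_def)
  have suma: "summable (\<lambda>n. 1 / (a n)\<^sup>2)" unfolding a_def by (rule inverse_square_pi_summable)
  define f where "f n x = ln (1 + x\<^sup>2 / (a n)\<^sup>2)" for n and x :: real
  define f' where "f' n x = 2 * x / (x\<^sup>2 + (a n)\<^sup>2)" for n and x :: real
  have pos: "1 + x\<^sup>2 / (a n)\<^sup>2 > 0" for n x by (intro add_pos_nonneg) auto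
  have pos2: "x\<^sup>2 + (a n)\<^sup>2 > 0" for n and x :: real using a[of n] by (intro add_nonneg_pos) auto
  have fsums: "(\<lambda>n. f n x) sums (ln (sinh (x / 2)) - ln (x / 2))" if x: "x > 0" for x
  proof -
    have "(\<lambda>n. (x / 2 * (\<Prod>k<n. 1 + x\<^sup>2 / (a k)\<^sup>2)) / (x / 2)) \<longlonglongrightarrow> sinh (x / 2) / (x / 2)"
      unfolding a_def using x by (intro tendsto_divide sinh_product_tendsto) auto
    hence "(\<lambda>n. (\<Prod>k<n. 1 + x\<^sup>2 / (a k)\<^sup>2)) \<longlonglongrightarrow> sinh (x / 2) / (x / 2)" using x by simp
    hence "(\<lambda>n. ln (\<Prod>k<n. 1 + x\<^sup>2 / (a k)\<^sup>2)) \<longlonglongrightarrow> ln (sinh (x / 2) / (x / 2))"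
      by (rule tendsto_ln) (use x in simp)
    moreover have "ln (\<Prod>k<n. 1 + x\<^sup>2 / (a k)\<^sup>2) = (\<Sum>k<n. f k x)" for n
      unfolding f_def by (intro ln_prod) (simp, metis pos less_irrefl)
    moreover have "ln (sinh (x / 2) / (x / 2)) = ln (sinh (x / 2)) - ln (x / 2)"
      using x by (intro ln_divide_pos) auto
    ultimately show ?thesis unfolding sums_def by (simp only:)
  qed
  have der: "(f n has_field_derivative f' n x) (at x within A)" for n x A
  proof -
    have "(f n has_field_derivative (2 * x / (a n)\<^sup>2) / (1 + x\<^sup>2 / (a n)\<^sup>2)) (at x within A)"
    proof -
      have "((\<lambda>x. x\<^sup>2) has_field_derivative 2 * x) (at x within A)" by (auto intro!: derivative_eq_intros)
      hence "((\<lambda>x. 1 + x\<^sup>2 / (a n)\<^sup>2) has_field_derivative 0 + 2 * x / (a n)\<^sup>2) (at x within A)"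
        by (intro DERIV_add DERIV_const DERIV_cdivide)
      from DERIV_chain2[OF DERIV_ln_divide[OF pos] this] show ?thesis
        by (simp add: f_def[abs_def] mult.commute)
    qed
    also have "(2 * x / (a n)\<^sup>2) / (1 + x\<^sup>2 / (a n)\<^sup>2) = f' n x"
    proof -
      have "a n \<noteq> 0" using a[of n] by simp
      hence "1 + x\<^sup>2 / (a n)\<^sup>2 = (x\<^sup>2 + (a n)\<^sup>2) / (a n)\<^sup>2" by (simp add: add_divide_distrib)
      thus ?thesis using \<open>a n \<noteq> 0\<close> by (simp add: f'_def)
    qed
    finally show ?thesis .
  qed
  \<comment> \<open>The interval has \<open>t\<close> in its interior and admits a majorant
    independent of \<open>x\<close>, so the series may be differentiated termwise.\<close>
  have "uniformly_convergent_on {0..2*t} (\<lambda>n x. \<Sum>i<n. f' i x)"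
  proof (rule Weierstrass_m_test'[OF _ summable_mult[OF suma]])
    fix n x assume x: "x \<in> {0..2*t}"
    have "norm (f' n x) = 2 * x / (x\<^sup>2 + (a n)\<^sup>2)" using x pos2[of x n] by (simp add: f'_def)
    also have "\<dots> \<le> (4 * t) / (a n)\<^sup>2" using x a[of n] by (intro frac_le) auto
    finally show "norm (f' n x) \<le> (4 * t) * (1 / (a n)\<^sup>2)" by simp
  qed
  from has_field_derivative_series'(2)[OF _ der this, of t] 
  have d1: "((\<lambda>x. \<Sum>n. f n x) has_field_derivative (\<Sum>n. f' n t)) (at t)"
    using fsums[OF t] t by (auto simp: sums_iff)
  have "((\<lambda>x. ln (sinh (x / 2)) - ln (x / 2)) has_field_derivative (cosh (t/2) / (2 * sinh (t/2)) - 1 / t)) (at t)"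
    using t by (auto intro!: derivative_eq_intros)
  hence d2: "((\<lambda>x. \<Sum>n. f n x) has_field_derivative (cosh (t/2) / (2 * sinh (t/2)) - 1 / t)) (at t)"
    by (rule has_field_derivative_transform_within_open[where S = "{0<..}"])
       (use t fsums in \<open>auto simp: sums_iff\<close>)
  have e: "exp t = exp (t/2) * exp (t/2)" by (simp flip: exp_add)
  have "cosh (t/2) / (2 * sinh (t/2)) = 1 / (exp t - 1) + 1 / 2"
  proof -
    have gt: "exp (t/2) * exp (t/2) > 1" using t by (simp flip: exp_add)
    have "cosh (t/2) / (2 * sinh (t/2)) = (exp (t/2) + 1 / exp (t/2)) / (2 * (exp (t/2) - 1 / exp (t/2)))"
    proof -
      have "(A / 2) / (2 * (B / 2)) = A / (2 * B)" for A B :: real by simp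
      thus ?thesis unfolding cosh_field_def sinh_field_def exp_minus inverse_eq_divide .
    qed
    also have "\<dots> = (exp (t/2) * exp (t/2) + 1) / (2 * (exp (t/2) * exp (t/2) - 1))"
      by (simp add: divide_simps)
    also have "\<dots> = 1 / (exp (t/2) * exp (t/2) - 1) + 1 / 2"
    proof -
      have "(u + 1) / (2 * (u - 1)) = 1 / (u - 1) + 1 / 2" if "u > 1" for u :: real
        using that by (simp add: divide_simps) (simp add: algebra_simps)
      thus ?thesis using gt .
    qed
    finally show ?thesis unfolding e .
  qed
  with DERIV_unique[OF d1 d2] have eq: "(\<Sum>n. f' n t) = bose_remainder t"
    by (simp add: bose_remainder_def)
  have "summable (\<lambda>n. f' n t)"
  proof (rule summable_comparison_test'[OF summable_mult[OF suma]])
    fix n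
    have "norm (f' n t) = 2 * t / (t\<^sup>2 + (a n)\<^sup>2)" using t pos2[of t n] by (simp add: f'_def)
    also have "\<dots> \<le> (2 * t) / (a n)\<^sup>2" using t a[of n] by (intro frac_le) auto
    finally show "norm (f' n t) \<le> (2 * t) * (1 / (a n)\<^sup>2)" by simp
  qed
  hence "(\<lambda>n. f' n t) sums bose_remainder t" using eq by (simp add: sums_iff)
  thus ?thesis by (simp add: f'_def a_def)
qed

lemma bose_remainder_bounds:
  obtains C where "\<And>t. t > 0 \<Longrightarrow> 0 \<le> bose_remainder t \<and> bose_remainder t \<le> C * t"
proof
  fix t :: real assume t: "t > 0"
  note s = bose_remainder_sums[OF t]
  have le: "2 * t / (t\<^sup>2 + (2 * pi * real (Suc n))\<^sup>2) \<le> 2 * t * (1 / (2 * pi * real (Suc n))\<^sup>2)" for n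
    using t by (simp, intro frac_le) auto
  have "bose_remainder t \<le> (\<Sum>n. 2 * t * (1 / (2 * pi * real (Suc n))\<^sup>2))"
    by (rule sums_le[OF le s]) (rule summable_sums[OF summable_mult[OF inverse_square_pi_summable]])
  also have "\<dots> = 2 * t * (\<Sum>n. 1 / (2 * pi * real (Suc n))\<^sup>2)"
    by (rule suminf_mult[OF inverse_square_pi_summable])
  finally show "0 \<le> bose_remainder t \<and> bose_remainder t \<le> (2 * (\<Sum>n. 1 / (2 * pi * real (Suc n))\<^sup>2)) * t"
    using t by (auto simp: mult_ac intro!: sums_le[OF _ sums_zero s])
qed

text \<open>The substitution \<open>v = t\<^sup>2 / (t\<^sup>2 + a\<^sup>2)\<close> leads to the
  Beta integral with parameters \<open>(s + 1) / 2\<close> and \<open>(1 - s) / 2\<close>. They add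
  up to \<open>1\<close>, so Euler's reflection formula evaluates it.\<close>

lemma nn_integral_powr_div_square_plus_square:
  fixes a s :: real
  assumes a: "a > 0" and s: "-1 < s" "s < 1"
  shows "(\<integral>\<^sup>+t. ennreal (indicator {0<..} t * (2 * t powr s / (t\<^sup>2 + a\<^sup>2))) \<partial>lborel)
      = ennreal (a powr (s - 1) * (pi / cos (pi * s / 2)))"
proof -
  define p q where "p = (s + 1) / 2" and "q = (1 - s) / 2"
  have pq: "p > 0" "q > 0" "p + q = 1" using s by (auto simp: p_def q_def field_simps)
  define g where "g t = t\<^sup>2 / (t\<^sup>2 + a\<^sup>2)" for t :: real
  define g' where "g' t = 2 * t * a\<^sup>2 / (t\<^sup>2 + a\<^sup>2)\<^sup>2" for t :: real
  define f where "f v = v powr (p - 1) * (1 - v) powr (q - 1)" for v :: real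
  have den: "t\<^sup>2 + a\<^sup>2 > 0" for t :: real using a by (intro add_nonneg_pos) auto
  have der: "(g has_field_derivative g' t) (at t within {0<..})" for t
    unfolding g_def using den[of t] 
    by (auto intro!: derivative_eq_intros simp: g'_def field_simps power2_eq_square)
  have inj: "inj_on g {0<..}"
  proof (rule inj_onI)
    fix x y :: real assume xy: "x \<in> {0<..}" "y \<in> {0<..}" "g x = g y"
    hence "x\<^sup>2 * (y\<^sup>2 + a\<^sup>2) = y\<^sup>2 * (x\<^sup>2 + a\<^sup>2)"
      using den[of x] den[of y] by (simp add: g_def field_simps)
    hence "x\<^sup>2 * a\<^sup>2 = y\<^sup>2 * a\<^sup>2" by (simp add: algebra_simps)
    hence "x\<^sup>2 = y\<^sup>2" using a by simp
    thus "x = y" using xy by (simp add: power2_eq_iff_nonneg)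
  qed
  have img: "g ` {0<..} = {0<..<1}"
  proof (intro equalityI subsetI)
    fix v assume "v \<in> g ` {0<..}"
    thus "v \<in> {0<..<1}" using den a by (auto simp: g_def divide_simps)
  next
    fix v :: real assume v: "v \<in> {0<..<1}"
    define t where "t = a * sqrt (v / (1 - v))"
    have t: "t > 0" "t\<^sup>2 = a\<^sup>2 * (v / (1 - v))" using v a by (auto simp: t_def power_mult_distrib)
    have "t\<^sup>2 + a\<^sup>2 = a\<^sup>2 / (1 - v)" unfolding t(2) using v by (simp add: field_simps)
    hence "g t = v" unfolding g_def t(2) using v a by (simp add: field_simps)
    thus "v \<in> g ` {0<..}" using t by force
  qed
  have Beta: "(f has_integral Beta p q) {0<..<1}"
    using has_integral_Beta_real[of p q] pq by (simp add: f_def[abs_def] has_integral_Icc_iff_Ioo)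
  have "f absolutely_integrable_on {0<..<1}"
    by (rule nonnegative_absolutely_integrable_1) (use Beta in \<open>auto simp: f_def\<close>)
  hence "f absolutely_integrable_on (g ` {0<..}) \<and> integral (g ` {0<..}) f = Beta p q"
    using Beta by (simp add: img integral_unique)
  hence "(\<lambda>t. \<bar>g' t\<bar> * f (g t)) absolutely_integrable_on {0<..} \<and> integral {0<..} (\<lambda>t. \<bar>g' t\<bar> * f (g t)) = Beta p q"
    by (subst has_absolute_integral_change_of_variables_1'[OF _ der inj]) auto
  hence hi: "((\<lambda>t. \<bar>g' t\<bar> * f (g t)) has_integral Beta p q) {0<..}"
    by (metis absolutely_integrable_on_def integrable_integral)
  have eq: "\<bar>g' t\<bar> * f (g t) = a powr (1 - s) * (2 * t powr s / (t\<^sup>2 + a\<^sup>2))" if t: "t \<in> {0<..}" for t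
  proof -
    define w where "w = t\<^sup>2 + a\<^sup>2"
    have w: "w > 0" using den by (simp add: w_def)
    have t0: "t > 0" using t by simp
    have "t\<^sup>2 = w - a\<^sup>2" by (simp add: w_def)
    hence 1: "1 - g t = a\<^sup>2 / w" using w by (simp add: g_def diff_divide_distrib flip: w_def)
    have pq2: "2 * (p - 1) = s - 1" "2 * (q - 1) = - s - 1" by (simp_all add: p_def q_def right_diff_distrib)
    have "t\<^sup>2 powr (p - 1) = t powr (2 * (p - 1))"
      using t0 by (simp add: powr_powr flip: powr_numeral)
    hence "t\<^sup>2 powr (p - 1) = t powr (s - 1)" unfolding pq2 .
    moreover have "a\<^sup>2 powr (q - 1) = a powr (2 * (q - 1))"
      using a by (simp add: powr_powr flip: powr_numeral)
    hence "a\<^sup>2 powr (q - 1) = a powr (- s - 1)" unfolding pq2 .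
    ultimately have "f (g t) = (t powr (s - 1) / w powr (p - 1)) * (a powr (- s - 1) / w powr (q - 1))"
      unfolding f_def 1 using w t0 a by (simp add: g_def powr_divide flip: w_def)
    also have "\<dots> = t powr (s - 1) * a powr (- s - 1) / w powr (p - 1 + (q - 1))"
      by (simp only: powr_add times_divide_times_eq)
    also have "p - 1 + (q - 1) = -1" using pq by simp
    also have "w powr -1 = 1 / w" using w by (simp add: powr_minus inverse_eq_divide)
    finally have "f (g t) = t powr (s - 1) * a powr (- s - 1) * w" by simp
    moreover have "\<bar>g' t\<bar> = 2 * t * a\<^sup>2 / (w * w)"
      using t0 w by (simp add: g'_def w_def power2_eq_square)
    ultimately have "\<bar>g' t\<bar> * f (g t) = 2 * (t * t powr (s - 1)) * (a\<^sup>2 * a powr (- s - 1)) / w"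
      using w by simp
    also have "t * t powr (s - 1) = t powr s" using t0 by (simp add: powr_diff)
    also have "a\<^sup>2 * a powr (- s - 1) = a powr (1 - s)"
      using a by (simp add: powr_add[symmetric] flip: powr_numeral)
    finally show ?thesis by (simp add: w_def)
  qed
  have "((\<lambda>t. a powr (s - 1) * (a powr (1 - s) * (2 * t powr s / (t\<^sup>2 + a\<^sup>2)))) has_integral a powr (s - 1) * Beta p q) {0<..}"
    using has_integral_eq[OF eq hi] by (rule has_integral_mult_right)
  also have "(\<lambda>t. a powr (s - 1) * (a powr (1 - s) * (2 * t powr s / (t\<^sup>2 + a\<^sup>2)))) = (\<lambda>t. 2 * t powr s / (t\<^sup>2 + a\<^sup>2))"
    using a by (simp add: mult.assoc[symmetric] powr_add[symmetric])
  finally have "((\<lambda>t. 2 * t powr s / (t\<^sup>2 + a\<^sup>2)) has_integral a powr (s - 1) * Beta p q) {0<..}" .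
  from nn_integral_has_integral_lebesgue[OF _ this]
  have "(\<integral>\<^sup>+t. ennreal (indicator {0<..} t * (2 * t powr s / (t\<^sup>2 + a\<^sup>2))) \<partial>lborel) = ennreal (a powr (s - 1) * Beta p q)"
    by simp
  also have "Beta p q = pi / cos (pi * s / 2)"
  proof -
    have "q = 1 - p" using pq by simp
    hence "Beta p q = Gamma p * Gamma (1 - p)" by (simp add: Beta_def)
    also have "complex_of_real \<dots> = of_real pi / sin (of_real pi * of_real p)"
      using Gamma_reflection_complex[of "of_real p"] Gamma_complex_of_real[of "1 - p"]
      by (simp add: Gamma_complex_of_real)
    also have "\<dots> = of_real (pi / sin (pi * p))" by (simp flip: sin_of_real)
    finally have "Beta p q = pi / sin (pi * p)" by (simp only: of_real_eq_iff)
    also have "pi * p = pi / 2 + pi * s / 2" by (simp add: p_def field_simps)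
    also have "sin (pi / 2 + pi * s / 2) = cos (pi * s / 2)" by (simp add: sin_add)
    finally show ?thesis .
  qed
  finally show ?thesis .
qed

lemma nn_integral_powr_exp:
  fixes a s :: real
  assumes a: "a > 0" and s: "s > 0"
  shows "(\<integral>\<^sup>+t. ennreal (indicator {0<..} t * (t powr (s - 1) * exp (- a * t))) \<partial>lborel) = ennreal (Gamma s * a powr - s)"
proof -
  let ?f = "\<lambda>t. ennreal (indicator {0..} t * t powr (s - 1) / exp t)"
  have "ennreal (Gamma s) = integral\<^sup>N lborel ?f" using Gamma_conv_nn_integral_real[OF s] .
  also have "\<dots> = ennreal \<bar>a\<bar> * (\<integral>\<^sup>+t. ?f (0 + a * t) \<partial>lborel)"
    using a by (intro nn_integral_real_affine) auto
  also have "(\<lambda>t. ?f (0 + a * t)) = (\<lambda>t. ennreal (a powr (s - 1)) * ennreal (indicator {0<..} t * (t powr (s - 1) * exp (- a * t))))"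
  proof (rule ext)
    fix t :: real
    show "?f (0 + a * t) = ennreal (a powr (s - 1)) * ennreal (indicator {0<..} t * (t powr (s - 1) * exp (- a * t)))"
    proof (cases "t > 0")
      case True
      hence "a * t > 0" using a by simp
      thus ?thesis using True a
        by (simp add: ennreal_mult'[symmetric] powr_mult exp_minus divide_inverse mult_ac)
    next
      case False
      thus ?thesis using a by (cases "t = 0") (auto simp: indicator_def zero_le_mult_iff)
    qed
  qed
  also have "(\<integral>\<^sup>+t. ennreal (a powr (s - 1)) * ennreal (indicator {0<..} t * (t powr (s - 1) * exp (- a * t))) \<partial>lborel)
     = ennreal (a powr (s - 1)) * (\<integral>\<^sup>+t. ennreal (indicator {0<..} t * (t powr (s - 1) * exp (- a * t))) \<partial>lborel)"
    by (intro nn_integral_cmult) auto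
  also have "ennreal \<bar>a\<bar> * (ennreal (a powr (s - 1)) * (\<integral>\<^sup>+t. ennreal (indicator {0<..} t * (t powr (s - 1) * exp (- a * t))) \<partial>lborel))
     = ennreal (a powr s) * (\<integral>\<^sup>+t. ennreal (indicator {0<..} t * (t powr (s - 1) * exp (- a * t))) \<partial>lborel)"
    using a by (simp add: mult.assoc[symmetric] ennreal_mult'[symmetric] powr_diff)
  finally have "ennreal (a powr - s) * ennreal (Gamma s) = ennreal (a powr - s) * (ennreal (a powr s) * (\<integral>\<^sup>+t. ennreal (indicator {0<..} t * (t powr (s - 1) * exp (- a * t))) \<partial>lborel))"
    by simp
  also have "\<dots> = (\<integral>\<^sup>+t. ennreal (indicator {0<..} t * (t powr (s - 1) * exp (- a * t))) \<partial>lborel)"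
    using a by (simp add: mult.assoc[symmetric] ennreal_mult'[symmetric] powr_add[symmetric])
  finally have "(\<integral>\<^sup>+t. ennreal (indicator {0<..} t * (t powr (s - 1) * exp (- a * t))) \<partial>lborel) = ennreal (a powr - s) * ennreal (Gamma s)"
    by (rule sym)
  also have "\<dots> = ennreal (a powr - s * Gamma s)" by (rule ennreal_mult'[symmetric]) simp
  finally show ?thesis by (simp only: mult.commute)
qed

lemma summable_Suc_powr:
  fixes s :: real
  assumes "s > 1"
  shows "summable (\<lambda>n. real (Suc n) powr - s)"
proof -
  have "summable (\<lambda>n. real n powr - s)" using assms by (subst summable_real_powr_iff) auto
  thus ?thesis by (subst summable_Suc_iff)
qed

text \<open>Expanding \<open>1 / (exp t - 1)\<close> as a geometric series in
  \<open>exp (- t)\<close> reduces this to Gamma integrals; nonnegativity permits the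
  exchange.\<close>

lemma nn_integral_bose:
  fixes s :: real
  assumes s: "s > 1"
  shows "(\<integral>\<^sup>+t. ennreal (indicator {0<..} t * (t powr (s - 1) / (exp t - 1))) \<partial>lborel)
           = ennreal (Gamma s * (\<Sum>n. real (Suc n) powr - s))"
proof -
  have "ennreal (indicator {0<..} t * (t powr (s - 1) / (exp t - 1)))
      = (\<Sum>n. ennreal (indicator {0<..} t * (t powr (s - 1) * exp (- real (Suc n) * t))))" for t :: real
  proof (cases "t > 0")
    case True
    have "(\<lambda>n. exp (- t) ^ n) sums (1 / (1 - exp (- t)))"
      using True by (intro geometric_sums) auto
    hence "(\<lambda>n. (t powr (s - 1) * exp (- t)) * exp (- t) ^ n) sums ((t powr (s - 1) * exp (- t)) * (1 / (1 - exp (- t))))"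
      by (rule sums_mult)
    also have "(\<lambda>n. (t powr (s - 1) * exp (- t)) * exp (- t) ^ n) = (\<lambda>n. t powr (s - 1) * exp (- real (Suc n) * t))"
    proof (rule ext)
      fix n
      have "- real (Suc n) * t = - t + real n * - t" by (simp add: algebra_simps)
      thus "(t powr (s - 1) * exp (- t)) * exp (- t) ^ n = t powr (s - 1) * exp (- real (Suc n) * t)"
        by (simp only: exp_add exp_of_nat_mult mult.assoc)
    qed
    also have "(t powr (s - 1) * exp (- t)) * (1 / (1 - exp (- t))) = t powr (s - 1) / (exp t - 1)"
      using True by (simp add: exp_minus divide_simps)
    finally have "(\<lambda>n. t powr (s - 1) * exp (- real (Suc n) * t)) sums (t powr (s - 1) / (exp t - 1))" .
    hence "(\<lambda>n. ennreal (t powr (s - 1) * exp (- real (Suc n) * t))) sums ennreal (t powr (s - 1) / (exp t - 1))"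
      by (subst sums_ennreal) (use True in auto)
    thus ?thesis using True by (simp add: sums_iff)
  qed simp
  hence "(\<integral>\<^sup>+t. ennreal (indicator {0<..} t * (t powr (s - 1) / (exp t - 1))) \<partial>lborel)
     = (\<integral>\<^sup>+t. (\<Sum>n. ennreal (indicator {0<..} t * (t powr (s - 1) * exp (- real (Suc n) * t)))) \<partial>lborel)"
    by simp
  also have "\<dots> = (\<Sum>n. \<integral>\<^sup>+t. ennreal (indicator {0<..} t * (t powr (s - 1) * exp (- real (Suc n) * t))) \<partial>lborel)"
    by (rule nn_integral_suminf) auto
  also have "\<dots> = (\<Sum>n. ennreal (Gamma s * real (Suc n) powr - s))"
    using s by (intro suminf_cong nn_integral_powr_exp) auto
  also have "\<dots> = ennreal (\<Sum>n. Gamma s * real (Suc n) powr - s)"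
    using s Gamma_real_pos[of s] by (intro suminf_ennreal2 summable_mult summable_Suc_powr) auto
  also have "(\<Sum>n. Gamma s * real (Suc n) powr - s) = Gamma s * (\<Sum>n. real (Suc n) powr - s)"
    by (rule suminf_mult[OF summable_Suc_powr[OF s]])
  finally show ?thesis .
qed

text \<open>The partial fractions are integrated termwise. Each term converges for
  \<open>-1 < s < 1\<close>; summing the resulting powers \<open>n powr (s - 1)\<close> requires
  \<open>s < 0\<close> and produces the zeta series at \<open>1 - s\<close>.\<close>

lemma nn_integral_bose_remainder:
  fixes s :: real
  assumes s: "-1 < s" "s < 0"
  shows "(\<integral>\<^sup>+t. ennreal (indicator {0<..} t * (bose_remainder t * t powr (s - 1))) \<partial>lborel)
     = ennreal ((2 * pi) powr (s - 1) * (pi / cos (pi * s / 2)) * (\<Sum>n. real (Suc n) powr - (1 - s)))"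
proof -
  define a where "a n = 2 * pi * real (Suc n)" for n
  have cos: "cos (pi * s / 2) > 0"
    using s mult_strict_left_mono[of "-1" s pi] mult_strict_left_mono[of s 0 pi] by (intro cos_gt_zero_pi) auto
  have "ennreal (indicator {0<..} t * (bose_remainder t * t powr (s - 1)))
      = (\<Sum>n. ennreal (indicator {0<..} t * (2 * t powr s / (t\<^sup>2 + (a n)\<^sup>2))))" for t :: real
  proof (cases "t > 0")
    case True
    have "(\<lambda>n. 2 * t / (t\<^sup>2 + (a n)\<^sup>2) * t powr (s - 1)) sums (bose_remainder t * t powr (s - 1))"
      unfolding a_def by (intro sums_mult2 bose_remainder_sums True)
    also have "(\<lambda>n. 2 * t / (t\<^sup>2 + (a n)\<^sup>2) * t powr (s - 1)) = (\<lambda>n. 2 * t powr s / (t\<^sup>2 + (a n)\<^sup>2))"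
      using True by (simp add: powr_diff)
    finally have *: "(\<lambda>n. 2 * t powr s / (t\<^sup>2 + (a n)\<^sup>2)) sums (bose_remainder t * t powr (s - 1))" .
    have "0 \<le> bose_remainder t * t powr (s - 1)"
      by (rule sums_le[OF _ sums_zero *]) simp
    with * have "(\<lambda>n. ennreal (2 * t powr s / (t\<^sup>2 + (a n)\<^sup>2))) sums ennreal (bose_remainder t * t powr (s - 1))"
      by (subst sums_ennreal) auto
    thus ?thesis using True by (simp add: sums_iff)
  qed simp
  hence "(\<integral>\<^sup>+t. ennreal (indicator {0<..} t * (bose_remainder t * t powr (s - 1))) \<partial>lborel)
     = (\<integral>\<^sup>+t. (\<Sum>n. ennreal (indicator {0<..} t * (2 * t powr s / (t\<^sup>2 + (a n)\<^sup>2)))) \<partial>lborel)"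
    by simp
  also have "\<dots> = (\<Sum>n. \<integral>\<^sup>+t. ennreal (indicator {0<..} t * (2 * t powr s / (t\<^sup>2 + (a n)\<^sup>2))) \<partial>lborel)"
    by (rule nn_integral_suminf) auto
  also have "\<dots> = (\<Sum>n. ennreal (a n powr (s - 1) * (pi / cos (pi * s / 2))))"
    using s by (intro suminf_cong nn_integral_powr_div_square_plus_square) (auto simp: a_def)
  also have "(\<lambda>n. a n powr (s - 1) * (pi / cos (pi * s / 2)))
      = (\<lambda>n. (2 * pi) powr (s - 1) * (pi / cos (pi * s / 2)) * real (Suc n) powr - (1 - s))"
  proof (rule ext)
    fix n
    have "a n powr (s - 1) = (2 * pi) powr (s - 1) * real (Suc n) powr (s - 1)"
      unfolding a_def by (rule powr_mult)
    thus "a n powr (s - 1) * (pi / cos (pi * s / 2))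
        = (2 * pi) powr (s - 1) * (pi / cos (pi * s / 2)) * real (Suc n) powr - (1 - s)"
      by (simp only: mult_ac minus_diff_eq)
  qed
  also have "(\<Sum>n. ennreal ((2 * pi) powr (s - 1) * (pi / cos (pi * s / 2)) * real (Suc n) powr - (1 - s)))
      = ennreal (\<Sum>n. (2 * pi) powr (s - 1) * (pi / cos (pi * s / 2)) * real (Suc n) powr - (1 - s))"
    using s cos by (intro suminf_ennreal2 summable_mult summable_Suc_powr) auto
  also have "(\<Sum>n. (2 * pi) powr (s - 1) * (pi / cos (pi * s / 2)) * real (Suc n) powr - (1 - s))
      = (2 * pi) powr (s - 1) * (pi / cos (pi * s / 2)) * (\<Sum>n. real (Suc n) powr - (1 - s))"
    using s by (intro suminf_mult summable_Suc_powr) auto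
  finally show ?thesis .
qed

section \<open>Integrability of the two halves of the Mellin integral, and their sum on both sides
  of the strip\<close>

lemma has_bochner_integral_nonneg_has_integral:
  fixes f :: "real \<Rightarrow> real"
  assumes [measurable]: "f \<in> borel_measurable borel" "A \<in> sets borel"
    and nn: "\<And>x. x \<in> A \<Longrightarrow> 0 \<le> f x" and I: "(f has_integral I) A"
  shows "has_bochner_integral lborel (\<lambda>x. indicator A x * f x) I"
proof (rule has_bochner_integral_nn_integral)
  show "0 \<le> I" using has_integral_nonneg[OF I] nn by auto
  show "AE x in lborel. 0 \<le> indicator A x * f x" using nn by (auto simp: indicator_def)
  show "(\<integral>\<^sup>+x. ennreal (indicator A x * f x) \<partial>lborel) = ennreal I"
    by (rule nn_integral_has_integral_lebesgue[OF nn I])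
qed measurable

lemma has_bochner_integral_powr_unit:
  fixes a :: real
  assumes "a > -1"
  shows "has_bochner_integral lborel (\<lambda>t. indicator {0<..<1} t * t powr a) (1 / (a + 1))"
  using has_integral_powr_from_0[OF assms, of 1]
  by (intro has_bochner_integral_nonneg_has_integral) (auto simp: has_integral_Icc_iff_Ioo)

lemma has_bochner_integral_powr_at_top:
  fixes a :: real
  assumes "a < -1"
  shows "has_bochner_integral lborel (\<lambda>t. indicator {1..} t * t powr a) (- 1 / (a + 1))"
  using has_integral_powr_to_inf[OF assms, of 1]
  by (intro has_bochner_integral_nonneg_has_integral) auto

lemma borel_measurable_bose_remainder [measurable]: "bose_remainder \<in> borel_measurable borel"
  unfolding bose_remainder_def[abs_def] by measurable

lemma integrable_bose_remainder_unit:
  fixes s :: real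
  assumes s: "s > -1"
  shows "integrable lborel (\<lambda>t. indicator {0<..<1} t * (bose_remainder t * t powr (s - 1)))"
proof -
  obtain C where C: "\<And>t. t > 0 \<Longrightarrow> 0 \<le> bose_remainder t \<and> bose_remainder t \<le> C * t"
    using bose_remainder_bounds by blast
  have "integrable lborel (\<lambda>t. C * (indicator {0<..<1} t * t powr s))"
    using has_bochner_integral_powr_unit[OF s] by (simp add: has_bochner_integral_iff)
  thus ?thesis
  proof (rule Bochner_Integration.integrable_bound)
    show "AE t in lborel. norm (indicator {0<..<1} t * (bose_remainder t * t powr (s - 1)))
        \<le> norm (C * (indicator {0<..<1} t * t powr s))"
    proof (rule AE_I2)
      fix t :: real
      show "norm (indicator {0<..<1} t * (bose_remainder t * t powr (s - 1)))
        \<le> norm (C * (indicator {0<..<1} t * t powr s))"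
      proof (cases "t \<in> {0<..<1}")
        case True
        hence t: "t > 0" by simp
        have "bose_remainder t * t powr (s - 1) \<le> C * t * t powr (s - 1)"
          using C[OF t] by (intro mult_right_mono) auto
        also have "\<dots> = C * t powr s" using t by (simp add: powr_diff)
        finally show ?thesis using True C[OF t] by simp
      qed simp
    qed
  qed measurable
qed

lemma integrable_bose_at_top:
  fixes s :: real
  shows "integrable lborel (\<lambda>t. indicator {1..} t * (t powr (s - 1) / (exp t - 1)))"
proof -
  \<comment> \<open>On \<open>t \<ge> 1\<close> a larger exponent only enlarges the integrand, and
    for \<open>p > 1\<close> the integral over the whole half-line is known to be finite.\<close>
  define p where "p = max s 2"
  have p: "p > 1" "s \<le> p" by (auto simp: p_def)
  have "has_bochner_integral lborel (\<lambda>t. indicator {0<..} t * (t powr (p - 1) / (exp t - 1)))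
       (Gamma p * (\<Sum>n. real (Suc n) powr - p))"
  proof (rule has_bochner_integral_nn_integral)
    show "0 \<le> Gamma p * (\<Sum>n. real (Suc n) powr - p)"
      using p Gamma_real_pos[of p] by (intro mult_nonneg_nonneg suminf_nonneg summable_Suc_powr) auto
    show "AE t in lborel. 0 \<le> indicator {0<..} t * (t powr (p - 1) / (exp t - 1))"
      by (intro AE_I2) (auto simp: indicator_def)
  qed (use nn_integral_bose[OF p(1)] in auto)
  hence "integrable lborel (\<lambda>t. indicator {0<..} t * (t powr (p - 1) / (exp t - 1)))"
    by (simp add: has_bochner_integral_iff)
  thus ?thesis
  proof (rule Bochner_Integration.integrable_bound)
    show "AE t in lborel. norm (indicator {1..} t * (t powr (s - 1) / (exp t - 1)))
       \<le> norm (indicator {0<..} t * (t powr (p - 1) / (exp t - 1)))"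
    proof (rule AE_I2)
      fix t :: real
      show "norm (indicator {1..} t * (t powr (s - 1) / (exp t - 1)))
       \<le> norm (indicator {0<..} t * (t powr (p - 1) / (exp t - 1)))"
      proof (cases "t \<ge> 1")
        case True
        have "t powr (s - 1) / (exp t - 1) \<le> t powr (p - 1) / (exp t - 1)"
          using True p by (intro divide_right_mono powr_mono) auto
        thus ?thesis using True by simp
      qed simp
    qed
  qed measurable
qed

text \<open>The rational terms are the integrals over \<open>{0<..<1}\<close> of
  \<open>t powr (s - 2)\<close> and \<open>- t powr (s - 1) / 2\<close>, which restore what
  \<open>bose_remainder\<close> removes. The left-hand side keeps its meaning for
  \<open>s > -1\<close> apart from \<open>0\<close> and \<open>1\<close>.\<close>

lemma bose_mellin_gt_1:
  fixes s :: real
  assumes s: "s > 1"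
  shows "(LINT t|lborel. indicator {0<..<1} t * (bose_remainder t * t powr (s - 1)))
    + (LINT t|lborel. indicator {1..} t * (t powr (s - 1) / (exp t - 1))) + 1 / (s - 1) - 1 / (2 * s)
    = Gamma s * (\<Sum>n. real (Suc n) powr - s)"
proof -
  let ?f0 = "\<lambda>t. indicator {0<..<1} t * (bose_remainder t * t powr (s - 1))"
  let ?f1 = "\<lambda>t. indicator {1..} t * (t powr (s - 1) / (exp t - 1)) :: real"
  let ?F = "\<lambda>t. indicator {0<..} t * (t powr (s - 1) / (exp t - 1)) :: real"
  have F: "has_bochner_integral lborel ?F (Gamma s * (\<Sum>n. real (Suc n) powr - s))"
  proof (rule has_bochner_integral_nn_integral)
    show "0 \<le> Gamma s * (\<Sum>n. real (Suc n) powr - s)"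
      using s Gamma_real_pos[of s] by (intro mult_nonneg_nonneg suminf_nonneg summable_Suc_powr) auto
    show "AE t in lborel. 0 \<le> ?F t" by (intro AE_I2) (auto simp: indicator_def)
  qed (use nn_integral_bose[OF s] in auto)
  have "has_bochner_integral lborel (\<lambda>t. ?f0 t + ?f1 t + indicator {0<..<1} t * t powr (s - 2)
      - indicator {0<..<1} t * t powr (s - 1) / 2)
     (integral\<^sup>L lborel ?f0 + integral\<^sup>L lborel ?f1 + 1 / (s - 2 + 1) - (1 / (s - 1 + 1)) / 2)"
    using s by (intro has_bochner_integral_add has_bochner_integral_diff has_bochner_integral_divide_zero
       has_bochner_integral_powr_unit has_bochner_integral_integrable integrable_bose_remainder_unit
       integrable_bose_at_top) auto
  also have "(\<lambda>t. ?f0 t + ?f1 t + indicator {0<..<1} t * t powr (s - 2) - indicator {0<..<1} t * t powr (s - 1) / 2) = ?F"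
  proof (rule ext)
    fix t :: real
    show "?f0 t + ?f1 t + indicator {0<..<1} t * t powr (s - 2) - indicator {0<..<1} t * t powr (s - 1) / 2 = ?F t"
    proof (cases "t \<in> {0<..<1}")
      case True
      hence "t powr (s - 2) = t powr (s - 1) / t" using powr_diff[of t "s - 1" 1] by simp
      thus ?thesis using True by (simp add: bose_remainder_def algebra_simps)
    qed (auto simp: indicator_def)
  qed
  finally show ?thesis using has_bochner_integral_eq[OF F] by (simp add: mult.commute)
qed

text \<open>The left-hand side is the one for \<open>s > 1\<close>. For negative \<open>s\<close>,
  however, \<open>1 / (s - 1)\<close> and \<open>- 1 / (2 * s)\<close> are the integrals over
  \<open>{1..}\<close> of \<open>- t powr (s - 2)\<close> and \<open>t powr (s - 1) / 2\<close>:
  they complete the remainder beyond \<open>1\<close> instead of undoing it below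
  \<open>1\<close>.\<close>

lemma bose_mellin_between_minus_1_0:
  fixes s :: real
  assumes s: "-1 < s" "s < 0"
  shows "(LINT t|lborel. indicator {0<..<1} t * (bose_remainder t * t powr (s - 1)))
    + (LINT t|lborel. indicator {1..} t * (t powr (s - 1) / (exp t - 1))) + 1 / (s - 1) - 1 / (2 * s)
    = (2 * pi) powr (s - 1) * (pi / cos (pi * s / 2)) * (\<Sum>n. real (Suc n) powr - (1 - s))"
    (is "_ = ?R")
proof -
  let ?f0 = "\<lambda>t. indicator {0<..<1} t * (bose_remainder t * t powr (s - 1))"
  let ?f1 = "\<lambda>t. indicator {1..} t * (t powr (s - 1) / (exp t - 1)) :: real"
  let ?F = "\<lambda>t. indicator {0<..} t * (bose_remainder t * t powr (s - 1)) :: real"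
  have cos: "cos (pi * s / 2) > 0"
    using s mult_strict_left_mono[of "-1" s pi] mult_strict_left_mono[of s 0 pi] by (intro cos_gt_zero_pi) auto
  have F: "has_bochner_integral lborel ?F ?R"
  proof (rule has_bochner_integral_nn_integral)
    show "0 \<le> ?R" using s cos by (intro mult_nonneg_nonneg suminf_nonneg summable_Suc_powr) auto
    show "AE t in lborel. 0 \<le> ?F t"
      using bose_remainder_bounds by (intro AE_I2) (metis indicator_simps greaterThan_iff mult_nonneg_nonneg
            powr_ge_zero mult_zero_left mult_1 order_refl)
  qed (use nn_integral_bose_remainder[OF s] in auto)
  have "has_bochner_integral lborel (\<lambda>t. ?f0 t + ?f1 t - indicator {1..} t * t powr (s - 2)
      + indicator {1..} t * t powr (s - 1) / 2)
     (integral\<^sup>L lborel ?f0 + integral\<^sup>L lborel ?f1 - (- 1 / (s - 2 + 1)) + (- 1 / (s - 1 + 1)) / 2)"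
    using s by (intro has_bochner_integral_add has_bochner_integral_diff has_bochner_integral_divide_zero
       has_bochner_integral_powr_at_top has_bochner_integral_integrable integrable_bose_remainder_unit
       integrable_bose_at_top) auto
  also have "(\<lambda>t. ?f0 t + ?f1 t - indicator {1..} t * t powr (s - 2) + indicator {1..} t * t powr (s - 1) / 2) = ?F"
  proof (rule ext)
    fix t :: real
    show "?f0 t + ?f1 t - indicator {1..} t * t powr (s - 2) + indicator {1..} t * t powr (s - 1) / 2 = ?F t"
    proof (cases "t \<ge> 1")
      case True
      hence "t powr (s - 2) = t powr (s - 1) / t" using powr_diff[of t "s - 1" 1] by simp
      thus ?thesis using True by (simp add: bose_remainder_def algebra_simps)
    qed (auto simp: indicator_def)
  qed
  finally show ?thesis using has_bochner_integral_eq[OF F] by (simp add: mult.commute)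
qed

section \<open>Continuation and functional equation of the zeta function\<close>

text \<open>The Mellin kernel \<open>t powr (s - 1)\<close> is split as \<open>exp (s * ln t) / t\<close>; the indicators hide the junk
  values at \<open>t \<le> 0\<close>.\<close>

definition bose_low :: "complex \<Rightarrow> complex" where
  "bose_low s = (\<integral>t. of_real (indicator {0<..<1} t * bose_remainder t / t) * exp (s * of_real (ln t)) \<partial>lborel)"

definition bose_high :: "complex \<Rightarrow> complex" where
  "bose_high s = (\<integral>t. of_real (indicator {1..} t / (t * (exp t - 1))) * exp (s * of_real (ln t)) \<partial>lborel)"

lemma exp_mult_ln_div: "t > 0 \<Longrightarrow> exp (s * ln t) / t = t powr (s - 1)" for t :: real
  by (simp add: powr_def exp_diff left_diff_distrib)

lemma bose_low_of_real:
  "bose_low (of_real s) = of_real (LINT t|lborel. indicator {0<..<1} t * (bose_remainder t * t powr (s - 1)))"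
proof -
  have "(\<lambda>t. complex_of_real (indicator {0<..<1} t * bose_remainder t / t) * exp (of_real s * of_real (ln t)))
     = (\<lambda>t. of_real (indicator {0<..<1} t * (bose_remainder t * t powr (s - 1))))"
  proof (rule ext)
    fix t :: real
    show "complex_of_real (indicator {0<..<1} t * bose_remainder t / t) * exp (of_real s * of_real (ln t))
       = of_real (indicator {0<..<1} t * (bose_remainder t * t powr (s - 1)))"
    proof (cases "t \<in> {0<..<1}")
      case True
      hence "t powr (s - 1) = exp (s * ln t) / t" by (simp add: exp_mult_ln_div)
      moreover have "exp (complex_of_real s * of_real (ln t)) = of_real (exp (s * ln t))"
        by (simp flip: exp_of_real)
      ultimately show ?thesis using True by simp
    qed simp
  qed
  thus ?thesis unfolding bose_low_def by (simp only: integral_complex_of_real)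
qed

lemma bose_high_of_real:
  "bose_high (of_real s) = of_real (LINT t|lborel. indicator {1..} t * (t powr (s - 1) / (exp t - 1)))"
proof -
  have "(\<lambda>t. complex_of_real (indicator {1..} t / (t * (exp t - 1))) * exp (of_real s * of_real (ln t)))
     = (\<lambda>t. of_real (indicator {1..} t * (t powr (s - 1) / (exp t - 1))))"
  proof (rule ext)
    fix t :: real
    show "complex_of_real (indicator {1..} t / (t * (exp t - 1))) * exp (of_real s * of_real (ln t))
       = of_real (indicator {1..} t * (t powr (s - 1) / (exp t - 1)))"
    proof (cases "t \<in> {1..}")
      case True
      hence "t powr (s - 1) = exp (s * ln t) / t" by (simp add: exp_mult_ln_div)
      moreover have "exp (complex_of_real s * of_real (ln t)) = of_real (exp (s * ln t))"
        by (simp flip: exp_of_real)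
      ultimately show ?thesis using True by simp
    qed simp
  qed
  thus ?thesis unfolding bose_high_def by (simp only: integral_complex_of_real)
qed

lemma holomorphic_bose_low: "bose_low holomorphic_on {s. Re s > -1}"
proof -
  have "(\<lambda>s. \<integral>t. of_real (indicator {0<..<1} t * bose_remainder t / t) * exp (s * of_real (ln t)) \<partial>lborel)
     holomorphic_on {s. Re s \<in> {-1<..}}"
  proof (rule holomorphic_on_exp_transform)
    fix \<sigma> :: real assume "\<sigma> \<in> {-1<..}"
    hence "integrable lborel (\<lambda>t. norm (indicator {0<..<1} t * (bose_remainder t * t powr (\<sigma> - 1))))"
      by (intro integrable_norm integrable_bose_remainder_unit) auto
    also have "(\<lambda>t. norm (indicator {0<..<1} t * (bose_remainder t * t powr (\<sigma> - 1))))
      = (\<lambda>t. norm (complex_of_real (indicator {0<..<1} t * bose_remainder t / t)) * exp (\<sigma> * ln t))"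
    proof (rule ext)
      fix t :: real
      show "norm (indicator {0<..<1} t * (bose_remainder t * t powr (\<sigma> - 1)))
         = norm (complex_of_real (indicator {0<..<1} t * bose_remainder t / t)) * exp (\<sigma> * ln t)"
      proof (cases "t \<in> {0<..<1}")
        case True
        hence "t powr (\<sigma> - 1) = exp (\<sigma> * ln t) / t" by (simp add: exp_mult_ln_div)
        thus ?thesis using True by (simp add: abs_mult norm_divide norm_mult)
      qed simp
    qed
    finally show "integrable lborel (\<lambda>t. norm (complex_of_real (indicator {0<..<1} t * bose_remainder t / t)) * exp (\<sigma> * ln t))" .
  qed measurable
  thus ?thesis by (simp add: bose_low_def[abs_def])
qed

lemma holomorphic_bose_high: "bose_high holomorphic_on A"
proof -
  have "(\<lambda>s. \<integral>t. of_real (indicator {1..} t / (t * (exp t - 1))) * exp (s * of_real (ln t)) \<partial>lborel)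
     holomorphic_on {s. Re s \<in> UNIV}"
  proof (rule holomorphic_on_exp_transform)
    fix \<sigma> :: real
    have "integrable lborel (\<lambda>t. norm (indicator {1..} t * (t powr (\<sigma> - 1) / (exp t - 1))))"
      by (intro integrable_norm integrable_bose_at_top)
    also have "(\<lambda>t. norm (indicator {1..} t * (t powr (\<sigma> - 1) / (exp t - 1))))
      = (\<lambda>t. norm (complex_of_real (indicator {1..} t / (t * (exp t - 1)))) * exp (\<sigma> * ln t))"
    proof (rule ext)
      fix t :: real
      show "norm (indicator {1..} t * (t powr (\<sigma> - 1) / (exp t - 1)))
         = norm (complex_of_real (indicator {1..} t / (t * (exp t - 1)))) * exp (\<sigma> * ln t)"
      proof (cases "t \<in> {1..}")
        case True
        hence "t powr (\<sigma> - 1) = exp (\<sigma> * ln t) / t" by (simp add: exp_mult_ln_div)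
        moreover have "norm (complex_of_real (1 / (t * (exp t - 1)))) = 1 / (t * (exp t - 1))"
          using True by (simp only: norm_of_real) simp
        ultimately show ?thesis using True by simp
      qed simp
    qed
    finally show "integrable lborel (\<lambda>t. norm (complex_of_real (indicator {1..} t / (t * (exp t - 1)))) * exp (\<sigma> * ln t))" .
  qed (simp, measurable)
  hence "bose_high holomorphic_on UNIV" by (simp add: bose_high_def[abs_def])
  thus ?thesis by (rule holomorphic_on_subset) simp
qed

section \<open>The Dirichlet series and the two half-plane formulas\<close>

definition zeta_series :: "complex \<Rightarrow> complex" where
  "zeta_series s = (\<Sum>n. 1 / of_nat (Suc n) powr s)"

lemma summable_zeta_series: "Re s > 1 \<Longrightarrow> summable (\<lambda>n. norm (1 / of_nat (Suc n) powr s :: complex))"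
  using summable_Suc_powr[of "Re s"]
  by (simp add: norm_divide norm_powr_real_powr powr_minus inverse_eq_divide)

lemma zeta_series_of_real:
  "s > 1 \<Longrightarrow> zeta_series (of_real s) = of_real (\<Sum>n. real (Suc n) powr - s)"
proof -
  assume s: "s > 1"
  have "1 / of_nat (Suc n) powr complex_of_real s = of_real (real (Suc n) powr - s)" for n
    using powr_of_real[of "real (Suc n)" s]
    by (simp add: powr_minus inverse_eq_divide)
  thus ?thesis using suminf_of_real[OF summable_Suc_powr[OF s], where ?'a = complex]
    by (simp add: zeta_series_def)
qed

text \<open>The series is an integral of \<open>exp (- s * ln (n + 1))\<close> over the counting
  measure, so the transform lemma applies.\<close>

lemma holomorphic_zeta_series: "zeta_series holomorphic_on {s. Re s > 1}"
proof -
  have "(\<lambda>s. \<integral>n. 1 * exp (s * of_real (- ln (real (Suc n)))) \<partial>count_space UNIV) holomorphic_on {s. Re s \<in> {1<..}}"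
  proof (rule holomorphic_on_exp_transform)
    fix \<sigma> :: real assume "\<sigma> \<in> {1<..}"
    hence "summable (\<lambda>n. real (Suc n) powr - \<sigma>)" by (intro summable_Suc_powr) auto
    thus "integrable (count_space UNIV) (\<lambda>n. norm (1::complex) * exp (\<sigma> * - ln (real (Suc n))))"
      by (simp add: integrable_count_space_nat_iff powr_def)
  qed auto
  moreover have "(\<integral>n. 1 * exp (s * of_real (- ln (real (Suc n)))) \<partial>count_space UNIV) = zeta_series s"
    if s: "s \<in> {s. Re s \<in> {1<..}}" for s
  proof -
    have eq: "1 * exp (s * of_real (- ln (real (Suc n)))) = 1 / of_nat (Suc n) powr s" for n
    proof -
      have "of_nat (Suc n) powr s = exp (s * of_real (ln (real (Suc n))))"
        unfolding powr_def using Ln_of_nat[of "Suc n"] by (simp del: of_nat_Suc)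
      thus ?thesis by (simp add: exp_minus inverse_eq_divide)
    qed
    show ?thesis unfolding eq zeta_series_def
      using summable_zeta_series[of s] s
      by (intro integral_count_space_nat) (simp add: integrable_count_space_nat_iff)
  qed
  ultimately have "zeta_series holomorphic_on {s. Re s \<in> {1<..}}" by (rule holomorphic_transform)
  thus ?thesis by simp
qed

text \<open>Multiplying by \<open>1/\<Gamma>\<close> cancels the pole of the Mellin transform at \<open>0\<close>; the last term is
  \<open>rGamma s / (2 * s)\<close>, written without the removable singularity.\<close>

definition zeta_right :: "complex \<Rightarrow> complex" where
  "zeta_right s = rGamma s * (bose_low s + bose_high s + 1 / (s - 1)) - rGamma (s + 1) / 2"

text \<open>The right-hand side of the functional equation with the series in place of zeta, which
  is legitimate because \<open>Re (1 - s) > 1\<close> when \<open>Re s < 0\<close>.\<close>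

definition zeta_left :: "complex \<Rightarrow> complex" where
  "zeta_left s = 2 * of_real (2 * pi) powr (s - 1) * sin (of_real pi * s / 2) * Gamma (1 - s) * zeta_series (1 - s)"

lemma zeta_right_of_real:
  assumes "s \<noteq> 0"
  shows "zeta_right (of_real s) = of_real (rGamma s * ((LINT t|lborel. indicator {0<..<1} t * (bose_remainder t * t powr (s - 1)))
    + (LINT t|lborel. indicator {1..} t * (t powr (s - 1) / (exp t - 1))) + 1 / (s - 1) - 1 / (2 * s)))"
proof -
  have "of_real s * rGamma (of_real s + 1) = (rGamma (of_real s) :: complex)" by (rule rGamma_plus1)
  hence "rGamma (of_real s + 1) / 2 = rGamma (of_real s :: complex) * (1 / (2 * of_real s))"
    using assms by (simp add: field_simps)
  hence "zeta_right (of_real s) = rGamma (of_real s) * (bose_low (of_real s) + bose_high (of_real s)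
      + 1 / (of_real s - 1) - 1 / (2 * of_real s))"
    unfolding zeta_right_def by (simp add: algebra_simps)
  thus ?thesis unfolding bose_low_of_real bose_high_of_real rGamma_complex_of_real by simp
qed

lemma zeta_right_eq_series:
  assumes "s > 1"
  shows "zeta_right (of_real s) = zeta_series (of_real s)"
proof -
  have "Gamma s > 0" using assms by (intro Gamma_real_pos) auto
  hence "rGamma s * Gamma s = 1"
    by (simp add: rGamma_inverse_Gamma)
  moreover have "zeta_right (of_real s) = of_real (rGamma s * (Gamma s * (\<Sum>n. real (Suc n) powr - s)))"
    unfolding bose_mellin_gt_1[OF assms, symmetric] using assms by (intro zeta_right_of_real) auto
  ultimately have "zeta_right (of_real s) = of_real (\<Sum>n. real (Suc n) powr - s)"
    by (simp only: mult.assoc[symmetric] mult_1_left)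
  thus ?thesis by (simp only: zeta_series_of_real[OF assms])
qed

text \<open>Reflection gives \<open>rGamma s = sin (pi * s) / pi * Gamma (1 - s)\<close>, and the
  double-angle formula cancels the cosine left over from the Beta integrals.\<close>

lemma zeta_right_eq_left:
  assumes s: "-1 < s" "s < 0"
  shows "zeta_right (of_real s) = zeta_left (of_real s)"
proof -
  define Z where "Z = (\<Sum>n. real (Suc n) powr - (1 - s))"
  have cos: "cos (pi * s / 2) > 0"
    using s mult_strict_left_mono[of "-1" s pi] mult_strict_left_mono[of s 0 pi] by (intro cos_gt_zero_pi) auto
  have "complex_of_real (rGamma s) * of_real (rGamma (1 - s)) = of_real (sin (pi * s) / pi)"
    using rGamma_reflection_complex[of "of_real s"] rGamma_complex_of_real[of s] rGamma_complex_of_real[of "1 - s"]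
    by (simp flip: sin_of_real)
  hence "rGamma s * rGamma (1 - s) = sin (pi * s) / pi"
    by (simp only: of_real_mult[symmetric] of_real_eq_iff)
  moreover have "Gamma (1 - s) > 0" using s by (intro Gamma_real_pos) auto
  hence "rGamma (1 - s) * Gamma (1 - s) = 1" by (simp add: rGamma_inverse_Gamma)
  ultimately have "rGamma s = sin (pi * s) / pi * Gamma (1 - s)"
    by (metis mult.assoc mult.right_neutral)
  also have "sin (pi * s) = 2 * sin (pi * s / 2) * cos (pi * s / 2)"
    using sin_double[of "pi * s / 2"] by simp
  finally have rG: "rGamma s * (pi / cos (pi * s / 2)) = 2 * sin (pi * s / 2) * Gamma (1 - s)"
    using cos by simp
  have "zeta_right (of_real s) = of_real (rGamma s * ((2 * pi) powr (s - 1) * (pi / cos (pi * s / 2)) * Z))"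
    unfolding Z_def using s by (subst zeta_right_of_real) (simp_all only: bose_mellin_between_minus_1_0)
  also have "rGamma s * ((2 * pi) powr (s - 1) * (pi / cos (pi * s / 2)) * Z)
     = (rGamma s * (pi / cos (pi * s / 2))) * (2 * pi) powr (s - 1) * Z"
    by (simp only: mult_ac)
  also have "\<dots> = 2 * (2 * pi) powr (s - 1) * sin (pi * s / 2) * Gamma (1 - s) * Z"
    unfolding rG by (simp only: mult_ac)
  also have "complex_of_real \<dots> = zeta_left (of_real s)"
  proof -
    have "complex_of_real (2 * pi) powr (of_real s - 1) = of_real ((2 * pi) powr (s - 1))"
      using powr_of_real[of "2 * pi" "s - 1"] by simp
    moreover have "sin (of_real pi * of_real s / 2) = complex_of_real (sin (pi * s / 2))"
      by (simp flip: sin_of_real)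
    moreover have "Gamma (1 - complex_of_real s) = of_real (Gamma (1 - s))"
      using Gamma_complex_of_real[of "1 - s"] by simp
    moreover have "zeta_series (1 - of_real s) = of_real Z"
      unfolding Z_def using zeta_series_of_real[of "1 - s"] s by simp
    ultimately show ?thesis unfolding zeta_left_def by simp
  qed
  finally show ?thesis .
qed

lemma holomorphic_zeta_right: "zeta_right holomorphic_on ({s. Re s > -1} - {1})"
proof -
  have "bose_low holomorphic_on ({s. Re s > -1} - {1})"
    by (rule holomorphic_on_subset[OF holomorphic_bose_low]) auto
  thus ?thesis unfolding zeta_right_def[abs_def]
    by (intro holomorphic_intros holomorphic_bose_high) auto
qed

lemma holomorphic_zeta_left: "zeta_left holomorphic_on {s. Re s < 0}"
proof -
  have "(zeta_series \<circ> (\<lambda>s. 1 - s)) holomorphic_on {s. Re s < 0}"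
    by (rule holomorphic_on_compose_gen[OF _ holomorphic_zeta_series]) (auto intro!: holomorphic_intros)
  moreover have "1 - s \<notin> \<int>\<^sub>\<le>\<^sub>0" if "Re s < 0" for s :: complex
    using that by (auto simp: nonpos_Ints_def complex_eq_iff)
  ultimately show ?thesis unfolding zeta_left_def[abs_def] o_def
    by (intro holomorphic_intros) auto
qed

lemma open_Re_gt: "open {s. Re s > a}" and open_Re_lt: "open {s. Re s < a}"
  by (rule open_halfspace_Re_gt, rule open_halfspace_Re_lt)

lemma open_connected_strip:
  "open {s. a < Re s \<and> Re s < b}" "connected {s. a < Re s \<and> Re s < b}"
proof -
  have eq: "{s. a < Re s \<and> Re s < b} = {s. Re s > a} \<inter> {s. Re s < b}" by auto
  show "open {s. a < Re s \<and> Re s < b}"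
    unfolding eq by (intro open_Int open_Re_gt open_Re_lt)
  show "connected {s. a < Re s \<and> Re s < b}"
    unfolding eq by (intro convex_connected convex_Int convex_halfspace_Re_gt convex_halfspace_Re_lt)
qed

text \<open>Both formulas are valid and equal on the strip \<open>-1 < Re s < 0\<close>, so the
  switch at \<open>-1\<close> creates no discontinuity. The value at \<open>1\<close> copies the
  dummy of \<open>riemann_zeta\<close>.\<close>

definition zeta_continued :: "complex \<Rightarrow> complex" where
  "zeta_continued s = (if s = 1 then 0 else if Re s > -1 then zeta_right s else zeta_left s)"

lemma zeta_continued_left:
  assumes "Re s < 0"
  shows "zeta_continued s = zeta_left s"
proof (cases "Re s > -1")
  case True
  have "zeta_right s = zeta_left s"
  proof (rule analytic_continuation_real_interval[where f = zeta_right and g = zeta_left and S = "{s. -1 < Re s \<and> Re s < 0}" and a = "-1" and b = 0])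
    show "zeta_right holomorphic_on {s. - 1 < Re s \<and> Re s < 0}"
      by (rule holomorphic_on_subset[OF holomorphic_zeta_right]) auto
    show "zeta_left holomorphic_on {s. - 1 < Re s \<and> Re s < 0}"
      by (rule holomorphic_on_subset[OF holomorphic_zeta_left]) auto
  qed (use True assms zeta_right_eq_left open_connected_strip in auto)
  thus ?thesis using True assms by (auto simp: zeta_continued_def)
qed (use assms in \<open>auto simp: zeta_continued_def\<close>)

lemma zeta_continued_series:
  assumes "Re s > 1"
  shows "zeta_continued s = zeta_series s"
proof -
  have "zeta_right s = zeta_series s"
  proof (rule analytic_continuation_real_interval[where f = zeta_right and g = zeta_series and S = "{s. Re s > 1}" and a = 1 and b = 2])
    show "zeta_right holomorphic_on {s. Re s > 1}"
      by (rule holomorphic_on_subset[OF holomorphic_zeta_right]) auto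
  qed (use assms holomorphic_zeta_series zeta_right_eq_series in
        \<open>auto simp: open_Re_gt convex_connected convex_halfspace_Re_gt\<close>)
  thus ?thesis using assms by (auto simp: zeta_continued_def)
qed

lemma holomorphic_zeta_continued: "zeta_continued holomorphic_on (- {1})"
proof -
  have "zeta_continued holomorphic_on ({s. Re s > -1} - {1})"
    using holomorphic_zeta_right by (rule holomorphic_transform) (auto simp: zeta_continued_def)
  moreover have "zeta_continued holomorphic_on {s. Re s < 0}"
    using holomorphic_zeta_left by (rule holomorphic_transform) (auto simp: zeta_continued_left)
  ultimately have "zeta_continued holomorphic_on (({s. Re s > -1} - {1}) \<union> {s. Re s < 0})"
    by (rule holomorphic_on_Un) (auto intro: open_Re_gt open_Re_lt)
  also have "({s. Re s > -1} - {1}) \<union> {s. Re s < 0} = - {1}"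
    by (auto simp: not_less)
  finally show ?thesis .
qed

text \<open>Uniqueness holds because the plane without \<open>1\<close> is connected and contains
  the half-plane of the series, while the value at \<open>1\<close> is prescribed
  separately.\<close>

lemma riemann_zeta_eq: "riemann_zeta = zeta_continued"
  unfolding riemann_zeta_def
proof (rule the_equality)
  show "zeta_continued holomorphic_on - {1} \<and>
    (\<forall>s. 1 < Re s \<longrightarrow> zeta_continued s = (\<Sum>n. 1 / of_nat (Suc n) powr s)) \<and> zeta_continued 1 = 0"
    using holomorphic_zeta_continued zeta_continued_series
    by (simp add: zeta_series_def zeta_continued_def)
next
  fix f :: "complex \<Rightarrow> complex"
  assume f: "f holomorphic_on - {1} \<and> (\<forall>s. 1 < Re s \<longrightarrow> f s = (\<Sum>n. 1 / of_nat (Suc n) powr s)) \<and> f 1 = 0"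
  show "f = zeta_continued"
  proof (rule ext)
    fix s
    show "f s = zeta_continued s"
    proof (cases "s = 1")
      case False
      show ?thesis
      proof (rule analytic_continuation_open[where f = f and g = zeta_continued and s = "{s. Re s > 1}" and s' = "- {1}"])
        show "{s. Re s > 1} \<noteq> {}" by (auto intro!: exI[of _ "2::complex"])
        show "connected (- {1::complex})" by (rule connected_punctured_universe) simp
        show "f z = zeta_continued z" if "z \<in> {s. Re s > 1}" for z
          using that f zeta_continued_series[of z] by (simp add: zeta_series_def)
      qed (use f False holomorphic_zeta_continued open_Re_gt in auto)
    qed (use f in \<open>simp add: zeta_continued_def\<close>)
  qed
qed

lemmas holomorphic_riemann_zeta = holomorphic_zeta_continued[folded riemann_zeta_eq]
lemmas riemann_zeta_series = zeta_continued_series[folded riemann_zeta_eq]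

text \<open>The factor \<open>rGamma 0 = 0\<close> kills the Mellin part, so only
  \<open>- rGamma 1 / 2\<close> remains. This keeps \<open>0\<close> out of the zeros.\<close>

lemma riemann_zeta_0: "riemann_zeta 0 = - 1 / 2"
  by (simp add: riemann_zeta_eq zeta_continued_def zeta_right_def)

text \<open>For \<open>Re s < 0\<close> the factor at \<open>1 - s\<close> is the series. Both sides
  stay holomorphic up to \<open>Re s < 1\<close> once \<open>0\<close> is removed, where
  \<open>1 - s\<close> meets the pole.\<close>

theorem riemann_zeta_functional_equation:
  assumes "Re s < 1" "s \<noteq> 0"
  shows "riemann_zeta s = 2 * of_real (2 * pi) powr (s - 1) * sin (of_real pi * s / 2) * Gamma (1 - s) * riemann_zeta (1 - s)"
    (is "_ = ?R s")
proof (rule analytic_continuation_open[where s = "{s. Re s < 0}" and s' = "{s. Re s < 1} - {0}" and f = riemann_zeta and g = ?R])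
  show "{s. Re s < 0} \<noteq> {}" by (auto intro!: exI[of _ "-1"])
  show "connected ({s. Re s < 1} - {0})"
    by (intro connected_open_delete open_Re_lt convex_connected convex_halfspace_Re_lt) simp
  show "riemann_zeta holomorphic_on {s. Re s < 1} - {0}"
    by (rule holomorphic_on_subset[OF holomorphic_riemann_zeta]) auto
  have "(riemann_zeta \<circ> (\<lambda>s. 1 - s)) holomorphic_on {s. Re s < 1} - {0}"
    by (rule holomorphic_on_compose_gen[OF _ holomorphic_riemann_zeta]) (auto intro!: holomorphic_intros)
  moreover have "1 - s \<notin> \<int>\<^sub>\<le>\<^sub>0" if "Re s < 1" for s :: complex
    using that by (auto simp: nonpos_Ints_def complex_eq_iff)
  ultimately show "?R holomorphic_on {s. Re s < 1} - {0}" unfolding o_def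
    by (intro holomorphic_intros) auto
  show "riemann_zeta z = ?R z" if "z \<in> {s. Re s < 0}" for z
    using that riemann_zeta_series[of "1 - z"]
    by (simp add: riemann_zeta_eq zeta_continued_left zeta_left_def)
qed (use assms open_Re_lt in \<open>auto intro: open_delete\<close>)

text \<open>Reflection sends \<open>s\<close> into the half-plane assumed free of zeros, and neither
  \<open>Gamma (1 - s)\<close> nor the power vanishes, so the sine must. Its zeros are the even
  integers; \<open>Re s < 1 / 2\<close> and the value at \<open>0\<close> leave the negative
  ones.\<close>

lemma riemann_zeta_zero_Re_less_half:
  assumes nz: "\<And>s. Re s > 1 / 2 \<Longrightarrow> s \<noteq> 1 \<Longrightarrow> riemann_zeta s \<noteq> 0"
    and s: "Re s < 1 / 2" "riemann_zeta s = 0"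
  shows "\<exists>n::nat. n \<ge> 1 \<and> s = - 2 * of_nat n"
proof -
  have s0: "s \<noteq> 0" using s riemann_zeta_0 by auto
  have "1 - s \<notin> \<int>\<^sub>\<le>\<^sub>0" using s by (auto simp: nonpos_Ints_def complex_eq_iff)
  hence "Gamma (1 - s) \<noteq> 0" by (simp add: Gamma_eq_zero_iff)
  moreover have "riemann_zeta (1 - s) \<noteq> 0" using s s0 by (intro nz) auto
  moreover have "complex_of_real (2 * pi) powr (s - 1) \<noteq> 0" by simp
  ultimately have "sin (of_real pi * s / 2) = 0"
    using riemann_zeta_functional_equation[of s] s s0 by auto
  then obtain k :: int where "of_real pi * s / 2 = of_int k * of_real pi"
    unfolding sin_eq_0 by (auto simp: complex_eq_iff)
  hence sk: "s = 2 * of_int k" by (simp add: field_simps)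
  have "real_of_int k < 1" using s(1) unfolding sk by simp
  hence "k \<le> 0" by simp
  moreover have "k \<noteq> 0" using s0 sk by auto
  ultimately have "nat (- k) \<ge> 1" "k = - int (nat (- k))" by auto
  thus ?thesis using sk by (metis minus_mult_right mult_minus_left of_int_minus of_int_of_nat_eq)
qed

section \<open>The Euler product\<close>

text \<open>By complete multiplicativity the multiples of \<open>p\<close> in a set sieved by other
  primes contribute \<open>f p\<close> times the sum over that set, so striking them out multiplies
  the sum by \<open>1 - f p\<close>.\<close>

lemma euler_sieve:
  fixes f :: "nat \<Rightarrow> complex"
  assumes f1: "f 1 = 1" and mult: "\<And>a b. f (a * b) = f a * f b"
    and sm: "f summable_on UNIV" and S: "finite S" "\<And>p. p \<in> S \<Longrightarrow> prime p"
  shows "infsum f {n. \<forall>p\<in>S. \<not> p dvd n} = infsum f UNIV * (\<Prod>p\<in>S. 1 - f p)"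
  using S
proof (induction S rule: finite_induct)
  case (insert p S)
  define A where "A = {n. \<forall>q\<in>S. \<not> q dvd n}"
  define B where "B = {n. \<forall>q\<in>insert p S. \<not> q dvd n}"
  have p: "prime p" using insert.prems by simp
  have disj: "B \<inter> (*) p ` A = {}" by (auto simp: A_def B_def)
  have AB: "A = B \<union> (*) p ` A"
  proof (intro equalityI subsetI)
    fix n assume n: "n \<in> A"
    show "n \<in> B \<union> (*) p ` A"
    proof (cases "p dvd n")
      case True
      then obtain m where m: "n = p * m" by (elim dvdE)
      have "m \<in> A" using n m by (auto simp: A_def)
      thus ?thesis using m by blast
    qed (use n in \<open>auto simp: A_def B_def\<close>)
  next
    fix n assume "n \<in> B \<union> (*) p ` A"
    thus "n \<in> A"
    proof
      assume "n \<in> (*) p ` A"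
      then obtain m where m: "n = p * m" "m \<in> A" by blast
      have "\<not> q dvd n" if q: "q \<in> S" for q
      proof
        assume "q dvd n"
        moreover have qp: "prime q" using insert.prems q by simp
        ultimately have "q dvd p \<or> q dvd m" using m by (simp add: prime_dvd_mult_iff)
        moreover have "\<not> q dvd m" using m q by (simp add: A_def)
        ultimately have "q = p" using p qp by (simp add: primes_dvd_imp_eq)
        thus False using q insert.hyps by simp
      qed
      thus ?thesis by (simp add: A_def)
    qed (auto simp: A_def B_def)
  qed
  have inj: "inj_on ((*) p) A" using p by (auto simp: inj_on_def prime_gt_0_nat)
  have sub: "f summable_on X" for X by (rule summable_on_subset_banach[OF sm]) simp
  have "infsum f A = infsum f B + infsum f ((*) p ` A)"
    by (subst AB) (rule infsum_Un_disjoint[OF sub sub disj])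
  also have "infsum f ((*) p ` A) = infsum (\<lambda>n. f p * f n) A"
    by (subst infsum_reindex[OF inj]) (simp add: o_def mult)
  also have "\<dots> = f p * infsum f A" by (rule infsum_cmult_right[OF sub])
  finally have "infsum f B = infsum f A - f p * infsum f A" by (metis add_diff_cancel_right')
  also have "\<dots> = infsum f A * (1 - f p)" by (simp add: right_diff_distrib mult.commute)
  also have "infsum f A = infsum f UNIV * (\<Prod>p\<in>S. 1 - f p)"
    unfolding A_def using insert.prems by (intro insert.IH) auto
  finally show ?case using insert.hyps by (simp add: B_def mult_ac)
qed simp

text \<open>After sieving by the primes below \<open>N\<close>, the survivors are \<open>1\<close>
  and numbers at least \<open>N\<close>, so the error is bounded by a tail of the series of
  norms.\<close>

lemma euler_product_tendsto:
  fixes f :: "nat \<Rightarrow> complex"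
  assumes f0: "f 0 = 0" and f1: "f 1 = 1" and mult: "\<And>a b. f (a * b) = f a * f b"
    and sm: "summable (\<lambda>n. norm (f n))"
  shows "(\<lambda>N. (\<Sum>n. f n) * (\<Prod>p | prime p \<and> p < N. 1 - f p)) \<longlonglongrightarrow> 1"
proof -
  have hs: "f summable_on UNIV" by (rule norm_summable_imp_summable_on[OF sm])
  have hsn: "(\<lambda>n. norm (f n)) summable_on UNIV"
    by (rule norm_summable_imp_summable_on) (use sm in simp)
  have sub: "f summable_on X" for X by (rule summable_on_subset_banach[OF hs]) simp
  have subn: "(\<lambda>n. norm (f n)) summable_on X" for X by (rule summable_on_subset_banach[OF hsn]) simp
  have sum_eq: "(\<Sum>n. f n) = infsum f UNIV"
    using norm_summable_imp_has_sum[OF sm summable_sums[OF summable_norm_cancel[OF sm]]]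
    by (rule infsumI[symmetric])
  have sumn_eq: "(\<Sum>n. norm (f n)) = infsum (\<lambda>n. norm (f n)) UNIV"
    using norm_summable_imp_has_sum[of "\<lambda>n. norm (f n)", OF _ summable_sums[OF sm]] sm
    by (intro infsumI[symmetric]) simp
  have bd: "norm ((\<Sum>n. f n) * (\<Prod>p | prime p \<and> p < N. 1 - f p) - 1) \<le> (\<Sum>n. norm (f n)) - (\<Sum>n<N. norm (f n))"
    if N: "N \<ge> 3" for N
  proof -
    define A where "A = {n. \<forall>p\<in>{p. prime p \<and> p < N}. \<not> p dvd n}"
    have eq: "infsum f A = (\<Sum>n. f n) * (\<Prod>p | prime p \<and> p < N. 1 - f p)"
      unfolding A_def sum_eq by (rule euler_sieve[OF f1 mult hs]) auto
    have 1: "1 \<in> A" by (auto simp: A_def)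
    have gt: "n \<in> {N..}" if n: "n \<in> A - {1}" for n
    proof (rule ccontr)
      assume "n \<notin> {N..}"
      hence nN: "n < N" by simp
      \<comment> \<open>Every prime divides \<open>0\<close>, and \<open>N \<ge> 3\<close> ensures
        that at least the prime \<open>2\<close> takes part in the sieve.\<close>
      have "n \<noteq> 0" 
      proof
        assume "n = 0"
        moreover have "2 \<in> {p. prime p \<and> p < N}" using N by simp
        ultimately have "\<not> 2 dvd (0::nat)" using n unfolding A_def by blast
        thus False by simp
      qed
      with n obtain p where p: "prime p" "p dvd n" using prime_factor_nat[of n] by auto
      hence "p \<le> n" using \<open>n \<noteq> 0\<close> by (auto intro: dvd_imp_le)
      thus False using p nN n by (auto simp: A_def)
    qed
    have "infsum f A = infsum f {1} + infsum f (A - {1})"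
      using infsum_Un_disjoint[OF sub[of "{1}"] sub[of "A - {1}"]] 1 by (simp add: insert_absorb)
    hence "norm (infsum f A - 1) = norm (infsum f (A - {1}))" using f1 by simp
    also have "\<dots> \<le> infsum (\<lambda>n. norm (f n)) (A - {1})"
      by (rule norm_infsum_bound[OF subn])
    also have "\<dots> \<le> infsum (\<lambda>n. norm (f n)) {N..}"
      by (rule infsum_mono_neutral[OF subn subn]) (use gt in auto)
    also have "\<dots> = infsum (\<lambda>n. norm (f n)) UNIV - infsum (\<lambda>n. norm (f n)) {..<N}"
    proof -
      have "UNIV = {..<N} \<union> {N..}" by auto
      hence "infsum (\<lambda>n. norm (f n)) UNIV = infsum (\<lambda>n. norm (f n)) {..<N} + infsum (\<lambda>n. norm (f n)) {N..}"
        using infsum_Un_disjoint[OF subn[of "{..<N}"] subn[of "{N..}"]] by (simp add: disjoint_iff)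
      thus ?thesis by simp
    qed
    finally show ?thesis unfolding eq sumn_eq by simp
  qed
  have "(\<lambda>N. (\<Sum>n. norm (f n)) - (\<Sum>n<N. norm (f n))) \<longlonglongrightarrow> 0"
    using tendsto_diff[OF tendsto_const[of "\<Sum>n. norm (f n)"] summable_LIMSEQ[OF sm]] by simp
  hence "(\<lambda>N. (\<Sum>n. f n) * (\<Prod>p | prime p \<and> p < N. 1 - f p) - 1) \<longlonglongrightarrow> 0"
    by (rule Lim_null_comparison[rotated]) (use bd in \<open>auto simp: eventually_at_top_linorder intro!: exI[of _ 3]\<close>)
  thus ?thesis by (simp add: LIM_zero_iff)
qed

text \<open>The genus-one factors make the product over primes converge for \<open>Re s > 1/2\<close>. Its zeros are
  irrelevant: only holomorphy is needed.\<close>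

lemma prime_weierstrass_product:
  obtains W where "W holomorphic_on {s. Re s > 1 / 2}"
    and "\<And>s. Re s > 1 / 2 \<Longrightarrow>
      (\<lambda>N. \<Prod>n<N. weierstrass_factor 1 (if prime n then exp (- s * of_real (ln (real n))) else 0)) \<longlonglongrightarrow> W s"
proof -
  \<comment> \<open>At a nonprime the argument \<open>0\<close> makes the Weierstrass factor
    \<open>1\<close>, so the product over all \<open>n\<close> is a product over primes.\<close>
  define z where "z n s = (if prime n then exp (- s * of_real (ln (real n))) else 0)" for n and s :: complex
  define P where "P N s = (\<Prod>n<N. weierstrass_factor 1 (z n s))" for N s
  define W where "W s = lim (\<lambda>N. P N s)" for s
  have holz: "z n holomorphic_on A" for n A
    unfolding z_def[abs_def] by (cases "prime n") (auto intro!: holomorphic_intros)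
  have holP: "P N holomorphic_on A" for N A
    unfolding P_def[abs_def] by (intro holomorphic_intros holz)
  have unif: "uniform_limit (cball s ((Re s - 1 / 2) / 2)) P W sequentially" if s: "Re s > 1 / 2" for s
  proof -
    define A where "A = cball s ((Re s - 1 / 2) / 2)"
    \<comment> \<open>The least real part on the disc, halfway between \<open>1 / 2\<close> and
      \<open>Re s\<close>.\<close>
    define \<sigma> where "\<sigma> = (Re s + 1 / 2) / 2"
    have \<sigma>: "\<sigma> > 1 / 2" using s by (simp add: \<sigma>_def)
    have Re_ge: "Re w \<ge> \<sigma>" if "w \<in> A" for w
    proof -
      have "\<bar>Re s - Re w\<bar> \<le> (Re s - 1 / 2) / 2"
        using that abs_Re_le_cmod[of "s - w"] by (simp add: A_def dist_norm)
      from abs_le_D1[OF this] show ?thesis by (simp add: \<sigma>_def field_simps)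
    qed
    \<comment> \<open>The genus-one factor differs from \<open>1\<close> by a multiple of the square
      of its argument, hence the summable exponent \<open>2 * \<sigma> > 1\<close>. From
      \<open>n = 4\<close> on, \<open>norm (z n w) \<le> 1 / 2\<close>, as the standard estimate
      requires.\<close>
    have bd: "norm (norm (weierstrass_factor 1 (z n w) - 1)) \<le> 3 * real n powr - (2 * \<sigma>)"
      if n: "n \<ge> 4" and w: "w \<in> A" for n w
    proof -
      have le: "norm (z n w) \<le> real n powr - \<sigma>"
        using Re_ge[OF w] n by (auto simp: z_def powr_def mult_right_mono)
      also have "\<dots> \<le> real n powr - (1 / 2)" using n \<sigma> by (intro powr_mono) auto
      also have "\<dots> \<le> 4 powr - (1 / 2)" using n by (intro powr_mono2') auto
      also have "(4::real) powr - (1 / 2) = 1 / 2" by (simp add: powr_minus powr_half_sqrt)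
      finally have "norm (z n w) \<le> 1 / 2" .
      hence "norm (weierstrass_factor 1 (z n w) - 1) \<le> 3 * norm (z n w) ^ Suc 1"
        by (rule weierstrass_factor_bound)
      also have "\<dots> \<le> 3 * (real n powr - \<sigma>) ^ Suc 1"
        by (intro mult_left_mono power_mono le) auto
      also have "(real n powr - \<sigma>) ^ Suc 1 = real n powr - (2 * \<sigma>)"
        by (simp add: power2_eq_square powr_add[symmetric])
      finally show ?thesis by simp
    qed
    have "uniformly_convergent_on A (\<lambda>N w. \<Sum>n<N. norm (weierstrass_factor 1 (z n w) - 1))"
    proof (rule Weierstrass_m_test'_ev)
      show "\<forall>\<^sub>F n in sequentially. \<forall>w\<in>A. norm (norm (weierstrass_factor 1 (z n w) - 1)) \<le> 3 * real n powr - (2 * \<sigma>)"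
        unfolding eventually_at_top_linorder using bd by blast
      show "summable (\<lambda>n. 3 * real n powr - (2 * \<sigma>))"
        using \<sigma> by (intro summable_mult) (simp add: summable_real_powr_iff)
    qed
    hence "uniformly_convergent_on A (\<lambda>N w. \<Prod>n<N. weierstrass_factor 1 (z n w))"
      by (intro uniformly_convergent_on_prod' holomorphic_on_imp_continuous_on holomorphic_intros holz)
         (auto simp: A_def)
    hence "uniformly_convergent_on A P" by (simp add: P_def[abs_def])
    thus ?thesis unfolding A_def[symmetric] W_def[abs_def]
      by (simp add: uniformly_convergent_uniform_limit_iff)
  qed
  have sub: "0 < (Re s - 1 / 2) / 2 \<and> cball s ((Re s - 1 / 2) / 2) \<subseteq> {s. Re s > 1 / 2}"
    if s: "Re s > 1 / 2" for s
  proof (intro conjI subsetI)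
    fix w assume "w \<in> cball s ((Re s - 1 / 2) / 2)"
    hence "\<bar>Re s - Re w\<bar> \<le> (Re s - 1 / 2) / 2"
      using abs_Re_le_cmod[of "s - w"] by (simp add: dist_norm)
    from abs_le_D1[OF this] show "w \<in> {s. Re s > 1 / 2}" using s by (simp add: field_simps)
  qed (use s in simp)
  show ?thesis
  proof
    show "W holomorphic_on {s. Re s > 1 / 2}"
    proof (rule holomorphic_uniform_sequence[OF open_Re_gt holP])
      show "\<exists>d>0. cball s d \<subseteq> {s. Re s > 1 / 2} \<and> uniform_limit (cball s d) P W sequentially"
        if "s \<in> {s. Re s > 1 / 2}" for s
        using that unif[of s] sub[of s] by blast
    qed
    fix s :: complex assume s: "Re s > 1 / 2"
    have "(\<lambda>N. P N s) \<longlonglongrightarrow> W s"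
      by (rule tendsto_uniform_limitI[OF unif[OF s]]) (use sub[OF s] in auto)
    thus "(\<lambda>N. \<Prod>n<N. weierstrass_factor 1 (if prime n then exp (- s * of_real (ln (real n))) else 0)) \<longlonglongrightarrow> W s"
      by (simp add: P_def z_def)
  qed
qed

text \<open>The factors \<open>(1 - p powr (- s)) * exp (p powr (- s))\<close> split into the Euler
  product, which tends to the inverse of zeta, and the exponential of the prime sum.\<close>

lemma zeta_times_weierstrass_product:
  fixes s :: real
  assumes s: "s > 1"
    and W: "(\<lambda>N. \<Prod>n<N. weierstrass_factor 1 (if prime n then exp (- of_real s * of_real (ln (real n))) else 0)) \<longlonglongrightarrow> w"
    and P: "(\<lambda>N. \<Sum>p | prime p \<and> p < N. real p powr - s) \<longlonglongrightarrow> P"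
  shows "riemann_zeta (of_real s) * w = of_real (exp P)"
proof -
  define f where "f n = complex_of_real (real n powr - s)" for n
  have sm: "summable (\<lambda>n. norm (f n))"
    using s unfolding f_def norm_of_real by (simp add: summable_real_powr_iff)
  have "(\<lambda>N. (\<Sum>n. f n) * (\<Prod>p | prime p \<and> p < N. 1 - f p)) \<longlonglongrightarrow> 1"
    by (rule euler_product_tendsto) (use sm in \<open>auto simp: f_def powr_mult\<close>)
  moreover have "(\<Sum>n. f n) = riemann_zeta (of_real s)"
  proof -
    have "(\<Sum>n. f n) = (\<Sum>n. f (Suc n)) + f 0"
      using suminf_split_head[OF summable_norm_cancel[OF sm]] by simp
    also have "\<dots> = of_real (\<Sum>n. real (Suc n) powr - s)"
      using suminf_of_real[OF summable_Suc_powr[OF s], where ?'a = complex] by (simp add: f_def)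
    finally show ?thesis using s by (simp add: riemann_zeta_series zeta_series_of_real)
  qed
  moreover have "(\<lambda>N. exp (of_real (\<Sum>p | prime p \<and> p < N. real p powr - s))) \<longlonglongrightarrow> exp (complex_of_real P)"
    by (intro tendsto_exp tendsto_of_real P)
  ultimately have "(\<lambda>N. (riemann_zeta (of_real s) * (\<Prod>p | prime p \<and> p < N. 1 - f p))
      * exp (of_real (\<Sum>p | prime p \<and> p < N. real p powr - s))) \<longlonglongrightarrow> 1 * exp (complex_of_real P)"
    by (intro tendsto_mult) simp_all
  moreover have "(riemann_zeta (of_real s) * (\<Prod>p | prime p \<and> p < N. 1 - f p))
      * exp (of_real (\<Sum>p | prime p \<and> p < N. real p powr - s))
    = riemann_zeta (of_real s) * (\<Prod>n<N. weierstrass_factor 1 (if prime n then exp (- of_real s * of_real (ln (real n))) else 0))" for N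
  proof -
    have fin: "finite {p. prime p \<and> p < N}" by simp
    have "exp (of_real (\<Sum>p | prime p \<and> p < N. real p powr - s)) = (\<Prod>p | prime p \<and> p < N. exp (f p))"
      by (simp add: f_def exp_sum[OF fin])
    hence "(\<Prod>p | prime p \<and> p < N. 1 - f p) * exp (of_real (\<Sum>p | prime p \<and> p < N. real p powr - s))
       = (\<Prod>p | prime p \<and> p < N. (1 - f p) * exp (f p))"
      by (simp add: prod.distrib)
    also have "\<dots> = (\<Prod>n<N. weierstrass_factor 1 (if prime n then exp (- of_real s * of_real (ln (real n))) else 0))"
    proof (rule prod.mono_neutral_cong_left)
      show "(1 - f p) * exp (f p) = weierstrass_factor 1 (if prime p then exp (- of_real s * of_real (ln (real p))) else 0)"
        if p: "p \<in> {p. prime p \<and> p < N}" for p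
      proof -
        have p0: "p > 0" using p prime_gt_0_nat by auto
        have "exp (- complex_of_real s * of_real (ln (real p))) = of_real (exp (- s * ln (real p)))"
          by (simp flip: exp_of_real)
        also have "exp (- s * ln (real p)) = real p powr - s" using p0 by (simp add: powr_def)
        finally show ?thesis using p by (simp add: f_def weierstrass_factor_def)
      qed
    qed auto
    finally show ?thesis by (simp only: mult.assoc)
  qed
  ultimately have "(\<lambda>N. riemann_zeta (of_real s) * (\<Prod>n<N. weierstrass_factor 1 (if prime n then exp (- of_real s * of_real (ln (real n))) else 0)))
     \<longlonglongrightarrow> 1 * exp (complex_of_real P)" by (simp only:)
  from LIMSEQ_unique[OF tendsto_mult[OF tendsto_const W] this] show ?thesis
    by (simp flip: exp_of_real)
qed

section \<open>The truncated expansions of the logarithmic integral\<close>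

text \<open>A one-sided Stirling bound. The induction step comes down to
  \<open>(m / (m + 1)) ^ (m + 1) \<le> exp (- 1)\<close>, an instance of
  \<open>1 + x \<le> exp x\<close>.\<close>

lemma fact_le_power_div_exp:
  assumes "m \<ge> 1"
  shows "(fact m :: real) \<le> exp 1 * real m * (real m / exp 1) ^ m"
  using assms
proof (induction m rule: nat_induct_at_least)
  case (Suc m)
  define q where "q = real m / (real m + 1)"
  have m: "real m > 0" using Suc by simp
  have "q = 1 + (-1 / (real m + 1))" using m by (simp add: q_def field_simps)
  hence "q \<le> exp (-1 / (real m + 1))" by (metis exp_ge_add_one_self)
  hence "q ^ Suc m \<le> exp (-1 / (real m + 1)) ^ Suc m"
    using m by (intro power_mono) (auto simp: q_def)
  also have "\<dots> = exp (-1)"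
    using m by (simp add: exp_of_nat_mult[symmetric] add.commute del: power_Suc)
  finally have *: "q ^ Suc m * exp 1 \<le> 1" by (simp add: exp_minus field_simps)
  have qm: "real m = q * (real m + 1)" using m by (simp add: q_def)
  have "(fact (Suc m) :: real) = (real m + 1) * fact m" by (simp add: algebra_simps)
  also have "\<dots> \<le> (real m + 1) * (exp 1 * real m * (real m / exp 1) ^ m)"
    using Suc.IH by (intro mult_left_mono) auto
  also have "\<dots> = exp 1 * (real m + 1) * (exp 1 * (real m / exp 1) ^ Suc m)"
    by simp
  also have "(real m / exp 1) ^ Suc m = q ^ Suc m * ((real m + 1) / exp 1) ^ Suc m"
    by (subst qm) (simp only: times_divide_eq_right[symmetric] power_mult_distrib)
  also have "exp 1 * (real m + 1) * (exp 1 * (q ^ Suc m * ((real m + 1) / exp 1) ^ Suc m))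
      = (q ^ Suc m * exp 1) * (exp 1 * (real m + 1) * ((real m + 1) / exp 1) ^ Suc m)"
    by (simp only: mult_ac)
  also have "\<dots> \<le> 1 * (exp 1 * (real m + 1) * ((real m + 1) / exp 1) ^ Suc m)"
    using * m by (intro mult_right_mono) auto
  finally show ?case by (simp add: add.commute)
qed simp

text \<open>The left-hand side is both the first omitted term and the derivative of the remainder. For
  \<open>m\<close> equal to \<open>\<kappa> t\<close> the exponent is exactly \<open>t - \<kappa> (1 - ln \<kappa>) t = t/2\<close>; convexity of
  \<open>y ln y - y\<close> handles the rounding, at the cost of a factor \<open>t\<close>.\<close>

lemma fact_exp_div_power_bound:
  fixes \<kappa> t :: real
  assumes \<kappa>: "\<kappa> > 0" "\<kappa> * (1 - ln \<kappa>) = 1 / 2" and t: "t \<ge> 1" and m: "real m \<le> \<kappa> * t" "\<kappa> * t \<le> real m + 1"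
  shows "fact m * exp t / t ^ Suc m \<le> (exp 1 * \<kappa> + exp (1 / (2 * \<kappa>))) * (t * exp (t / 2))"
proof (cases "m = 0")
  case True
  \<comment> \<open>For \<open>m = 0\<close> the range of \<open>t\<close> is bounded, and the
    summand \<open>exp (1 / (2 * \<kappa>))\<close> of the constant covers it.\<close>
  have "t \<le> 1 / \<kappa>" using m True \<kappa> by (simp add: field_simps)
  hence "exp (t / 2) \<le> exp (1 / (2 * \<kappa>))" by simp
  hence "exp (t/2) * exp (t/2) \<le> exp (1 / (2 * \<kappa>)) * exp (t/2)" by (intro mult_right_mono) auto
  hence "exp t \<le> exp (1 / (2 * \<kappa>)) * exp (t/2)" by (simp flip: exp_add)
  also have "\<dots> \<le> (exp 1 * \<kappa> + exp (1 / (2 * \<kappa>))) * (t * exp (t / 2))"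
    using t \<kappa> by (intro mult_mono) auto
  finally have *: "exp t \<le> (exp 1 * \<kappa> + exp (1 / (2 * \<kappa>))) * (t * exp (t / 2))" .
  have "exp t / t \<le> exp t" using t by (simp add: divide_le_eq)
  with * show ?thesis using True by simp
next
  case False
  define y where "y = \<kappa> * t"
  have m1: "real m \<ge> 1" using False by simp
  have y: "y > 0" "real m \<le> y" "y \<le> real m + 1" using m m1 by (auto simp: y_def)
  have "ln (real m / y) \<le> real m / y - 1" using m1 y by (intro ln_le_minus_one) auto
  hence "y * (ln (real m) - ln y) \<le> y * (real m / y - 1)"
    using m1 y by (intro mult_left_mono) (auto simp: ln_div)
  also have "\<dots> = real m - y" using y by (simp add: field_simps)
  finally have 1: "y * ln (real m) - y * ln y \<le> real m - y" by (simp add: algebra_simps)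
  have "ln y = ln \<kappa> + ln t" using \<kappa> t by (simp add: y_def ln_mult)
  hence "y * ln y - y = t * (- (\<kappa> * (1 - ln \<kappa>))) + y * ln t"
    by (simp add: y_def algebra_simps)
  hence 2: "y * ln y - y = - t / 2 + y * ln t" unfolding \<kappa>(2) by simp
  have 3: "(y - real m) * ln t \<le> 1 * ln t" using y t by (intro mult_right_mono) auto
  have 4: "(y - real m) * ln (real m) \<ge> 0" using y m1 by simp
  \<comment> \<open>Passing from \<open>y\<close> to \<open>m\<close> costs
    \<open>(y - m) * ln t\<close>, at most \<open>ln t\<close>; exponentiated, this is the extra
    factor \<open>t\<close>.\<close>
  have le: "t + real m * (ln (real m) - ln t - 1) \<le> t / 2 + ln t"
    using 1 2 3 4 by (simp add: algebra_simps)
  have "(real m / exp 1) ^ m / t ^ m = exp (ln (real m / (exp 1 * t))) ^ m"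
    using m1 t by (simp add: power_divide power_mult_distrib)
  also have "ln (real m / (exp 1 * t)) = ln (real m) - ln t - 1"
    using m1 t by (simp add: ln_div ln_mult)
  finally have 5: "(real m / exp 1) ^ m / t ^ m = exp (real m * (ln (real m) - ln t - 1))"
    by (simp add: exp_of_nat_mult)
  have "fact m * exp t / t ^ Suc m \<le> exp 1 * real m * (real m / exp 1) ^ m * exp t / t ^ Suc m"
    using t m1 by (intro divide_right_mono mult_right_mono fact_le_power_div_exp) auto
  also have "\<dots> = exp 1 * (real m / t) * (exp t * ((real m / exp 1) ^ m / t ^ m))"
    by (simp add: field_simps)
  also have "\<dots> = exp 1 * (real m / t) * exp (t + real m * (ln (real m) - ln t - 1))"
    unfolding 5 by (simp add: exp_add)
  also have "\<dots> \<le> exp 1 * \<kappa> * exp (t / 2 + ln t)"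
    using le m t \<kappa> by (intro mult_mono) (auto simp: divide_le_eq)
  also have "\<dots> = exp 1 * \<kappa> * (t * exp (t / 2))" using t by (simp add: exp_add)
  also have "\<dots> \<le> (exp 1 * \<kappa> + exp (1 / (2 * \<kappa>))) * (t * exp (t / 2))"
    using t by (intro mult_right_mono) auto
  finally show ?thesis .
qed

text \<open>Repeated integration by parts: differentiating \<open>fact m * exp t / t ^ Suc m\<close>
  reproduces that term minus the following one, so subtracting it moves the derivative of the
  remainder one place on.\<close>

lemma has_real_derivative_expint_remainder:
  fixes E :: "real \<Rightarrow> real"
  assumes E: "\<And>t. t > 0 \<Longrightarrow> (E has_real_derivative exp t / t) (at t)" and t: "t > 0"
  shows "((\<lambda>t. E t - exp t / t * (\<Sum>k<m. fact k / t ^ k)) has_real_derivative fact m * exp t / t ^ Suc m) (at t)"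
proof (induction m)
  case 0
  show ?case using E[OF t] by simp
next
  case (Suc m)
  have "((\<lambda>t. exp t / t ^ Suc m) has_real_derivative
      (exp t * t ^ Suc m - exp t * (real (Suc m) * t ^ m)) / (t ^ Suc m * t ^ Suc m)) (at t)"
    using DERIV_divide[OF DERIV_exp DERIV_pow[of "Suc m"], of t] t by simp
  also have "(exp t * t ^ Suc m - exp t * (real (Suc m) * t ^ m)) / (t ^ Suc m * t ^ Suc m)
      = exp t / t ^ Suc m - real (Suc m) * exp t / t ^ Suc (Suc m)"
    using t by (simp add: diff_divide_distrib)
  finally have "((\<lambda>t. fact m * (exp t / t ^ Suc m)) has_real_derivative
      fact m * (exp t / t ^ Suc m - real (Suc m) * exp t / t ^ Suc (Suc m))) (at t)"
    by (rule DERIV_cmult)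
  from DERIV_diff[OF Suc.IH this] show ?case
    by (simp add: algebra_simps)
qed

text \<open>For fixed \<open>m\<close> the bound on the derivative holds only while \<open>m\<close>
  is the integer part of \<open>\<kappa> * t\<close>, so the estimate follows the changing index by
  induction. About \<open>\<kappa> * t\<close> pieces, each costing a multiple of
  \<open>t * exp (t / 2)\<close>, give the factor \<open>t\<^sup>2\<close>.\<close>

lemma li_partial_sum_bound:
  fixes E :: "real \<Rightarrow> real" and \<kappa> :: real
  assumes E: "\<And>t. t > 0 \<Longrightarrow> (E has_real_derivative exp t / t) (at t)"
    and \<kappa>: "\<kappa> > 0" "\<kappa> * (1 - ln \<kappa>) = 1 / 2"
  obtains C where "\<And>t. t \<ge> 1 \<Longrightarrow> \<bar>E t - li0 \<kappa> (exp t)\<bar> \<le> C * (t\<^sup>2 * exp (t / 2))"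
    and "\<And>t. t \<ge> 1 \<Longrightarrow> \<bar>E t - li1 \<kappa> (exp t)\<bar> \<le> C * (t\<^sup>2 * exp (t / 2))"
proof -
  define K where "K = exp 1 * \<kappa> + exp (1 / (2 * \<kappa>))"
  define w where "w t = t * exp (t / 2)" for t :: real
  define D where "D m t = E t - exp t / t * (\<Sum>k<m. fact k / t ^ k)" for m t
  have K0: "K \<ge> 0" using \<kappa> by (simp add: K_def)
  have w0: "w t \<ge> 0" if "t \<ge> 1" for t using that by (simp add: w_def)
  have wmono: "w a \<le> w t" if "1 \<le> a" "a \<le> t" for a t
    using that unfolding w_def by (intro mult_mono) auto
  have bound: "fact m * exp t / t ^ Suc m \<le> K * w t"
    if "t \<ge> 1" "real m \<le> \<kappa> * t" "\<kappa> * t \<le> real m + 1" for m t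
    unfolding K_def w_def using fact_exp_div_power_bound[OF \<kappa> that] .
  \<comment> \<open>One piece without a jump: the mean value theorem on an interval of length at
    most \<open>1 / \<kappa>\<close>. The weak inequalities on \<open>j\<close> admit both
    endpoints.\<close>
  have step: "\<bar>D j t - D j a\<bar> \<le> K / \<kappa> * w t"
    if a: "1 \<le> a" "a \<le> t" "t \<le> a + 1 / \<kappa>" "real j \<le> \<kappa> * a" "\<kappa> * t \<le> real j + 1" for j a t
  proof (cases "a = t")
    case True
    thus ?thesis using K0 \<kappa> w0[of t] a by simp
  next
    case False
    with a have "a < t" by simp
    then obtain z where z: "a < z" "z < t"
      and eq: "D j t - D j a = (t - a) * (fact j * exp z / z ^ Suc j)"
      using MVT2[of a t "D j" "\<lambda>z. fact j * exp z / z ^ Suc j"]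
        has_real_derivative_expint_remainder[OF E] a unfolding D_def by force
    have "\<kappa> * a \<le> \<kappa> * z" "\<kappa> * z \<le> \<kappa> * t" using z \<kappa> by simp_all
    hence "fact j * exp z / z ^ Suc j \<le> K * w z" using a z by (intro bound) auto
    also have "\<dots> \<le> K * w t" using a z K0 by (intro mult_left_mono wmono) auto
    finally have *: "fact j * exp z / z ^ Suc j \<le> K * w t" .
    have "\<bar>D j t - D j a\<bar> = (t - a) * (fact j * exp z / z ^ Suc j)"
      unfolding eq using a z by (intro abs_of_nonneg mult_nonneg_nonneg divide_nonneg_nonneg) auto
    also have "\<dots> \<le> (1 / \<kappa>) * (K * w t)"
      using * a z \<kappa> by (intro mult_mono) auto
    finally show ?thesis by simp
  qed
  \<comment> \<open>The integer part at the starting point \<open>t = 1\<close>.\<close>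
  define j0 where "j0 = nat \<lfloor>\<kappa>\<rfloor>"
  have j0: "real j0 \<le> \<kappa>" "\<kappa> < real j0 + 1" unfolding j0_def using \<kappa> by linarith+
  define A where "A = \<bar>D j0 1\<bar>"
  define B where "B = K / \<kappa> + K"
  have B: "B \<ge> 0" "A \<ge> 0" "K / \<kappa> \<le> B" using K0 \<kappa> by (auto simp: A_def B_def)
  have w1: "1 \<le> w t" if "1 \<le> t" for t
    using that mult_mono[of 1 t 1 "exp (t/2)"] by (simp add: w_def)
  have main: "\<bar>D j t\<bar> \<le> (A + (real j + 1) * B) * w t"
    if "j \<ge> j0" "1 \<le> t" "real j \<le> \<kappa> * t" "\<kappa> * t \<le> real j + 1" for j t
    using that
  proof (induction j arbitrary: t rule: dec_induct)
    case base
    have "t \<le> (real j0 + 1) / \<kappa>" using base \<kappa> by (simp add: field_simps)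
    also have "\<dots> \<le> 1 + 1 / \<kappa>" using j0 \<kappa> by (simp add: field_simps)
    finally have "\<bar>D j0 t - D j0 1\<bar> \<le> K / \<kappa> * w t" using base j0 by (intro step) auto
    hence "\<bar>D j0 t\<bar> \<le> A * 1 + K / \<kappa> * w t" unfolding A_def by linarith
    also have "\<dots> \<le> A * w t + ((real j0 + 1) * B) * w t"
    proof (intro add_mono mult_left_mono mult_right_mono)
      show "K / \<kappa> \<le> (real j0 + 1) * B" using B mult_right_mono[of 1 "real j0 + 1" B] by simp
    qed (use B base w1 w0 in auto)
    finally show ?case by (simp add: algebra_simps)
  next
    case (step j)
    \<comment> \<open>Here \<open>\<kappa> * a\<close> reaches \<open>j + 1\<close>:
      \<open>D j\<close> is still controlled, the index jumps, and \<open>D (Suc j)\<close> takes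
      over. The jump and the new piece together cost \<open>K + K / \<kappa>\<close>, which is
      \<open>B\<close>.\<close>
    define a where "a = (real j + 1) / \<kappa>"
    have "\<kappa> < real j + 1" using j0 step.hyps by linarith
    hence a1: "1 \<le> a" using \<kappa> by (simp add: a_def field_simps)
    have ka: "\<kappa> * a = real j + 1" using \<kappa> by (simp add: a_def)
    have at: "a \<le> t" using step.prems \<kappa> by (simp add: a_def field_simps)
    have ta: "t \<le> a + 1 / \<kappa>" using step.prems \<kappa> by (simp add: a_def field_simps)
    have 1: "\<bar>D j a\<bar> \<le> (A + (real j + 1) * B) * w a" by (rule step.IH) (use a1 ka in auto)
    also have "\<dots> \<le> (A + (real j + 1) * B) * w t"
      using B a1 at by (intro mult_left_mono wmono) auto
    finally have 1: "\<bar>D j a\<bar> \<le> (A + (real j + 1) * B) * w t" .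
    have "fact j * exp a / a ^ Suc j \<le> K * w a" by (rule bound) (use a1 ka in auto)
    also have "\<dots> \<le> K * w t" using K0 a1 at by (intro mult_left_mono wmono) auto
    finally have 2: "fact j * exp a / a ^ Suc j \<le> K * w t" .
    have 3: "D (Suc j) a = D j a - fact j * exp a / a ^ Suc j"
      by (simp add: D_def algebra_simps)
    have 4: "fact j * exp a / a ^ Suc j \<ge> 0" using a1 by simp
    have 5: "\<bar>D (Suc j) t - D (Suc j) a\<bar> \<le> K / \<kappa> * w t"
      by (rule \<open>\<And>t j a. 1 \<le> a \<Longrightarrow> a \<le> t \<Longrightarrow> t \<le> a + 1 / \<kappa> \<Longrightarrow> real j \<le> \<kappa> * a \<Longrightarrow> \<kappa> * t \<le> real j + 1 \<Longrightarrow> _\<close>)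
         (use a1 at ta ka step.prems in auto)
    have "\<bar>D (Suc j) t\<bar> \<le> (A + (real j + 1) * B) * w t + K * w t + K / \<kappa> * w t"
      using 1 2 3 4 5 by linarith
    also have "\<dots> = (A + (real (Suc j) + 1) * B) * w t" by (simp add: B_def algebra_simps)
    finally show ?case .
  qed
  define C where "C = A + (\<kappa> + 1) * B + K"
  have tw: "t\<^sup>2 * exp (t / 2) = t * w t" for t by (simp add: w_def power2_eq_square)
  have fl: "real (nat \<lfloor>\<kappa> * t\<rfloor>) \<le> \<kappa> * t" "\<kappa> * t \<le> real (nat \<lfloor>\<kappa> * t\<rfloor>) + 1" "nat \<lfloor>\<kappa> * t\<rfloor> \<ge> j0"
    if "t \<ge> 1" for t
  proof -
    have "\<kappa> * 1 \<le> \<kappa> * t" using \<kappa> that by (intro mult_left_mono) auto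
    thus "nat \<lfloor>\<kappa> * t\<rfloor> \<ge> j0" unfolding j0_def by (intro nat_mono floor_mono) simp
    have "0 \<le> \<kappa> * t" using \<kappa> that by simp
    thus "real (nat \<lfloor>\<kappa> * t\<rfloor>) \<le> \<kappa> * t" "\<kappa> * t \<le> real (nat \<lfloor>\<kappa> * t\<rfloor>) + 1" by linarith+
  qed
  have fin: "\<bar>D (nat \<lfloor>\<kappa> * t\<rfloor>) t\<bar> + K * w t \<le> C * (t\<^sup>2 * exp (t / 2))" if t: "t \<ge> 1" for t
  proof -
    have "real (nat \<lfloor>\<kappa> * t\<rfloor>) + 1 \<le> (\<kappa> + 1) * t" using fl[OF t] t by (simp add: algebra_simps)
    hence "(real (nat \<lfloor>\<kappa> * t\<rfloor>) + 1) * B \<le> ((\<kappa> + 1) * t) * B" using B by (intro mult_right_mono)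
    moreover have "A * 1 \<le> A * t" "K * 1 \<le> K * t" using B K0 t by (intro mult_left_mono; simp)+
    ultimately have "A + (real (nat \<lfloor>\<kappa> * t\<rfloor>) + 1) * B + K \<le> C * t"
      by (simp add: C_def algebra_simps)
    hence "(A + (real (nat \<lfloor>\<kappa> * t\<rfloor>) + 1) * B + K) * w t \<le> C * t * w t"
      using w0 t by (intro mult_right_mono) auto
    moreover have "\<bar>D (nat \<lfloor>\<kappa> * t\<rfloor>) t\<bar> \<le> (A + (real (nat \<lfloor>\<kappa> * t\<rfloor>) + 1) * B) * w t"
      using fl[OF t] t by (intro main) auto
    ultimately show ?thesis unfolding tw by (simp add: algebra_simps)
  qed
  show ?thesis
  proof (rule that)
    fix t :: real assume t: "t \<ge> 1"
    have nn: "K * w t \<ge> 0" using K0 w0[OF t] by simp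
    have "E t - li0 \<kappa> (exp t) = D (nat \<lfloor>\<kappa> * t\<rfloor>) t" by (simp add: li0_def D_def)
    thus "\<bar>E t - li0 \<kappa> (exp t)\<bar> \<le> C * (t\<^sup>2 * exp (t / 2))" using fin[OF t] nn by linarith
    let ?m = "nat \<lfloor>\<kappa> * t\<rfloor>"
    \<comment> \<open>\<open>li1\<close> includes the term of index \<open>?m\<close> that
      \<open>D ?m\<close> leaves out; the summand \<open>K * w t\<close> in \<open>fin\<close> pays
      for it.\<close>
    have "E t - li1 \<kappa> (exp t) = D ?m t - fact ?m * exp t / t ^ Suc ?m"
      by (simp add: li1_def D_def lessThan_Suc_atMost[symmetric] algebra_simps)
    moreover have "fact ?m * exp t / t ^ Suc ?m \<le> K * w t" using fl[OF t] t by (intro bound) auto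
    moreover have "fact ?m * exp t / t ^ Suc ?m \<ge> 0" using t by simp
    ultimately show "\<bar>E t - li1 \<kappa> (exp t)\<bar> \<le> C * (t\<^sup>2 * exp (t / 2))" using fin[OF t] nn by linarith
  qed
qed

section \<open>Primes and the exponential integral\<close>

text \<open>\<open>H\<close> is the entire function Ein, the integral of
  \<open>(1 - exp (- u)) / u\<close> from \<open>0\<close>. It describes both the exponential
  integral, through \<open>ln t - h (- t)\<close>, and the regular part of its Laplace
  transform.\<close>

lemma entire_exponential_integral:
  obtains H :: "complex \<Rightarrow> complex" and h :: "real \<Rightarrow> real"
  where "H holomorphic_on UNIV" and "\<And>x. H (of_real x) = of_real (h x)"
    and "\<And>x. x \<noteq> 0 \<Longrightarrow> (h has_real_derivative (1 - exp (- x)) / x) (at x)"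
    and "continuous_on UNIV h"
proof -
  \<comment> \<open>Written as the difference quotient of \<open>- exp (- z)\<close> at
    \<open>0\<close>, so that the singularity is visibly removable.\<close>
  define \<phi> where "\<phi> z = (if z = 0 then deriv (\<lambda>z. - exp (- z)) 0 else (- exp (- z) - - exp (- 0)) / (z - 0))" for z :: complex
  have "\<phi> holomorphic_on UNIV"
    unfolding \<phi>_def[abs_def] by (rule pole_lemma) (auto intro!: holomorphic_intros)
  then obtain H where H: "(H has_field_derivative \<phi> z) (at z)" for z
    using holomorphic_convex_primitive'[of UNIV \<phi>] by auto
  have real: "\<exists>y::real. \<phi> (of_real x) = of_real y \<and> (x \<noteq> 0 \<longrightarrow> y = (1 - exp (- x)) / x)" for x :: real
  proof (cases "x = 0")
    case True
    have "((\<lambda>z::complex. - exp (- z)) has_field_derivative 1) (at 0)"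
      by (auto intro!: derivative_eq_intros)
    hence "\<phi> (of_real x) = of_real 1" using True by (simp add: \<phi>_def DERIV_imp_deriv)
    thus ?thesis using True by blast
  next
    case False
    have "\<phi> (of_real x) = of_real ((1 - exp (- x)) / x)"
      using False by (simp add: \<phi>_def flip: exp_of_real)
    thus ?thesis by blast
  qed
  have vd: "((\<lambda>x. H (of_real x)) has_vector_derivative \<phi> (of_real x)) (at x)" for x :: real
    by (rule has_vector_derivative_real_field[OF H])
  define h where "h x = Re (H (of_real x) - H 0)" for x :: real
  \<comment> \<open>The imaginary part has derivative zero along the real axis, so subtracting
    \<open>H 0\<close> makes the primitive real there.\<close>
  have "((\<lambda>x. Im (H (of_real x))) has_vector_derivative Im (\<phi> (of_real x))) (at x)" for x :: real
    by (rule bounded_linear.has_vector_derivative[OF bounded_linear_Im vd])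
  moreover have "Im (\<phi> (of_real x)) = 0" for x using real[of x] by auto
  ultimately have "\<forall>x. ((\<lambda>x. Im (H (of_real x))) has_real_derivative 0) (at x)"
    by (simp add: has_real_derivative_iff_has_vector_derivative)
  from DERIV_isconst_all[OF this] have Im0: "Im (H (of_real x)) = Im (H (of_real 0))" for x .
  have hd: "(h has_real_derivative Re (\<phi> (of_real x))) (at x)" for x
  proof -
    have "((\<lambda>x. Re (H (of_real x)) - Re (H 0)) has_vector_derivative Re (\<phi> (of_real x)) - 0) (at x)"
      by (intro has_vector_derivative_diff bounded_linear.has_vector_derivative[OF bounded_linear_Re vd]
           has_vector_derivative_const)
    thus ?thesis by (simp add: has_real_derivative_iff_has_vector_derivative h_def[abs_def])
  qed
  show ?thesis
  proof
    show "(\<lambda>z. H z - H 0) holomorphic_on UNIV"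
      by (intro holomorphic_intros) (use H in \<open>auto simp: holomorphic_on_open\<close>)
    show "H (of_real x) - H 0 = of_real (h x)" for x
      using Im0[of x] by (simp add: h_def complex_eq_iff)
    show "(h has_real_derivative (1 - exp (- x)) / x) (at x)" if "x \<noteq> 0" for x
      using hd[of x] real[of x] that by auto
    show "continuous_on UNIV h" using hd by (intro continuous_at_imp_continuous_on) (auto intro: DERIV_isCont)
  qed
qed

text \<open>The derivative of \<open>ln x - h x\<close> is \<open>exp (- x) / x\<close>. The
  function therefore increases, while adding \<open>exp (- x)\<close> makes it nonincreasing from
  \<open>1\<close> on, which bounds it.\<close>

lemma ln_minus_ein_tendsto:
  fixes h :: "real \<Rightarrow> real"
  assumes h: "\<And>x. x \<noteq> 0 \<Longrightarrow> (h has_real_derivative (1 - exp (- x)) / x) (at x)"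
  obtains c where "((\<lambda>x. ln x - h x) \<longlongrightarrow> c) at_top"
proof -
  define g where "g x = ln x - h x" for x
  have gd: "(g has_real_derivative exp (- x) / x) (at x)" if "x > 0" for x
  proof -
    have "(g has_real_derivative 1 / x - (1 - exp (- x)) / x) (at x)"
      unfolding g_def[abs_def] using that by (intro DERIV_diff h DERIV_ln_divide) auto
    thus ?thesis by (simp add: diff_divide_distrib)
  qed
  have mono: "g x \<le> g y" if "1 \<le> x" "x \<le> y" for x y
    using that by (intro DERIV_nonneg_imp_nondecreasing[of x y g]) (auto intro!: exI gd)
  have bd: "g x \<le> g 1 + exp (- 1)" if "1 \<le> x" for x
  proof -
    have "g x + exp (- x) \<le> g 1 + exp (- 1)"
    proof (rule DERIV_nonpos_imp_nonincreasing[of 1 x "\<lambda>x. g x + exp (- x)"])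
      fix y :: real assume y: "1 \<le> y"
      have "((\<lambda>x. g x + exp (- x)) has_real_derivative exp (- y) / y + exp (- y) * - 1) (at y)"
        using y by (intro DERIV_add gd) (auto intro!: derivative_eq_intros)
      moreover have "exp (- y) / y + exp (- y) * - 1 \<le> 0"
        using y by (simp add: divide_le_eq)
      ultimately show "\<exists>z. ((\<lambda>x. g x + exp (- x)) has_real_derivative z) (at y) \<and> z \<le> 0" by blast
    qed (use that in auto)
    thus ?thesis using exp_ge_zero[of "- x"] by linarith
  qed
  have bdd: "bdd_above (g ` {1..})" using bd by (intro bdd_aboveI[of _ "g 1 + exp (- 1)"]) auto
  have "(g \<longlongrightarrow> Sup (g ` {1..})) at_top"
  proof (rule increasing_tendsto)
    show "\<forall>\<^sub>F x in at_top. g x \<le> Sup (g ` {1..})"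
      unfolding eventually_at_top_linorder by (rule exI[of _ 1]) (auto intro!: cSup_upper bdd)
    fix y assume "y < Sup (g ` {1..})"
    then obtain x where x: "x \<ge> 1" "y < g x" using less_cSup_iff[OF _ bdd, of y] by auto
    have "y < g u" if "u \<ge> x" for u using x that mono[of x u] by linarith
    thus "\<forall>\<^sub>F x in at_top. y < g x" unfolding eventually_at_top_linorder by blast
  qed
  thus ?thesis using that by (simp add: g_def[abs_def])
qed

section \<open>The prime counting error and its Laplace transform\<close>

lemma finite_primes_le_real: "finite {p::nat. prime p \<and> real p \<le> x}"
  by (rule finite_subset[of _ "{..nat \<lfloor>x\<rfloor>}"]) (auto simp: le_nat_floor)

lemma primes_pi_mono: "x \<le> y \<Longrightarrow> primes_pi x \<le> primes_pi y"
  unfolding primes_pi_def by (intro card_mono finite_primes_le_real) auto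

lemma borel_measurable_primes_pi_exp [measurable]:
  "(\<lambda>t. real (primes_pi (exp t))) \<in> borel_measurable borel"
  by (rule borel_measurable_mono) (auto simp: mono_def intro!: primes_pi_mono)

text \<open>Here \<open>h\<close> is an antiderivative of \<open>(1 - exp (- x)) / x\<close>; the constant is chosen so that the
  function vanishes at \<open>1\<close>.\<close>

definition expint :: "(real \<Rightarrow> real) \<Rightarrow> real \<Rightarrow> real" where
  "expint h t = ln t - h (- t) + h (- 1)"

lemma has_real_derivative_expint:
  assumes h: "\<And>x. x \<noteq> 0 \<Longrightarrow> (h has_real_derivative (1 - exp (- x)) / x) (at x)" and t: "t > 0"
  shows "(expint h has_real_derivative exp t / t) (at t)"
proof -
  have "((\<lambda>t. h (- t)) has_real_derivative (1 - exp (- (- t))) / (- t) * (- 1)) (at t)"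
    by (rule DERIV_chain2[OF h]) (use t in \<open>auto intro!: derivative_eq_intros\<close>)
  hence "((\<lambda>t. ln t - h (- t) + h (- 1)) has_real_derivative 1 / t - (1 - exp (- (- t))) / (- t) * (- 1) + 0) (at t)"
    by (intro DERIV_add DERIV_diff DERIV_const DERIV_ln_divide t)
  thus ?thesis using t by (simp add: expint_def[abs_def] diff_divide_distrib)
qed

text \<open>The term \<open>expint h\<close> enters only at \<open>1\<close>, where it vanishes; the
  cut makes no jump and avoids the logarithm at \<open>0\<close>.\<close>

definition prime_error :: "(real \<Rightarrow> real) \<Rightarrow> real \<Rightarrow> real" where
  "prime_error h t = indicator {0<..} t * real (primes_pi (exp t)) - indicator {1..} t * expint h t"

lemma borel_measurable_prime_error:
  assumes "continuous_on UNIV h"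
  shows "prime_error h \<in> borel_measurable borel"
proof -
  have [measurable]: "h \<in> borel_measurable borel" by (rule borel_measurable_continuous_onI[OF assms])
  show ?thesis unfolding prime_error_def[abs_def] expint_def[abs_def] by measurable
qed

lemma prime_error_nonpos: "t \<le> 0 \<Longrightarrow> prime_error h t = 0"
  by (simp add: prime_error_def)

lemma prime_error_exp_bound:
  assumes bd: "\<And>t. t \<ge> 1 \<Longrightarrow> \<bar>real (primes_pi (exp t)) - expint h t\<bar> \<le> C * (t\<^sup>2 * exp (t / 2))"
    and \<delta>: "\<delta> > 0"
  obtains K where "K \<ge> 0" and "\<And>t. t > 0 \<Longrightarrow> \<bar>prime_error h t\<bar> \<le> K * exp ((1 / 2 + \<delta>) * t)"
proof
  \<comment> \<open>The summand \<open>2 / \<delta>\<^sup>2\<close> absorbs \<open>t\<^sup>2\<close>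
    into \<open>exp (\<delta> * t)\<close> by the quadratic Taylor bound;
    \<open>primes_pi (exp 1)\<close> covers \<open>0 < t < 1\<close>.\<close>
  define K where "K = (\<bar>C\<bar> + real (primes_pi (exp 1))) * (1 + 2 / \<delta>\<^sup>2)"
  show "K \<ge> 0" unfolding K_def by simp
  fix t :: real assume t: "t > 0"
  have "1 + \<delta> * t + (\<delta> * t)\<^sup>2 / 2 \<le> exp (\<delta> * t)"
    using \<delta> t by (intro exp_lower_Taylor_quadratic) auto
  hence 1: "1 \<le> exp (\<delta> * t)" "(\<delta> * t)\<^sup>2 / 2 \<le> exp (\<delta> * t)"
    using \<delta> t zero_le_power2[of "\<delta> * t"] mult_pos_pos[OF \<delta> t] by linarith+
  have "t\<^sup>2 = 2 / \<delta>\<^sup>2 * ((\<delta> * t)\<^sup>2 / 2)" using \<delta> by (simp add: power_mult_distrib)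
  also have "\<dots> \<le> 2 / \<delta>\<^sup>2 * exp (\<delta> * t)" using 1 \<delta> by (intro mult_left_mono) auto
  finally have "1 + t\<^sup>2 \<le> (1 + 2 / \<delta>\<^sup>2) * exp (\<delta> * t)"
    unfolding distrib_right mult_1_left by (rule add_mono[OF 1(1)])
  hence "(1 + t\<^sup>2) * exp (t / 2) \<le> (1 + 2 / \<delta>\<^sup>2) * exp (\<delta> * t) * exp (t / 2)"
    by (rule mult_right_mono) simp
  also have "\<dots> = (1 + 2 / \<delta>\<^sup>2) * exp ((1 / 2 + \<delta>) * t)"
    by (simp add: mult.assoc exp_add[symmetric] algebra_simps)
  finally have 2: "(1 + t\<^sup>2) * exp (t / 2) \<le> (1 + 2 / \<delta>\<^sup>2) * exp ((1 / 2 + \<delta>) * t)" .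
  have "\<bar>prime_error h t\<bar> \<le> (\<bar>C\<bar> + real (primes_pi (exp 1))) * ((1 + t\<^sup>2) * exp (t / 2))"
  proof (cases "t \<ge> 1")
    case True
    have "\<bar>prime_error h t\<bar> \<le> C * (t\<^sup>2 * exp (t / 2))"
      using bd[OF True] True by (simp add: prime_error_def)
    also have "\<dots> \<le> (\<bar>C\<bar> + real (primes_pi (exp 1))) * ((1 + t\<^sup>2) * exp (t / 2))"
      by (intro mult_mono mult_right_mono) auto
    finally show ?thesis .
  next
    case False
    have "\<bar>prime_error h t\<bar> = real (primes_pi (exp t)) * (1 * 1)"
      using False t by (simp add: prime_error_def)
    also have "\<dots> \<le> (\<bar>C\<bar> + real (primes_pi (exp 1))) * ((1 + t\<^sup>2) * exp (t / 2))"
      using False t primes_pi_mono[of "exp t" "exp 1"] by (intro mult_mono) auto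
    finally show ?thesis .
  qed
  also have "\<dots> \<le> (\<bar>C\<bar> + real (primes_pi (exp 1))) * ((1 + 2 / \<delta>\<^sup>2) * exp ((1 / 2 + \<delta>) * t))"
    using 2 by (intro mult_left_mono) auto
  finally show "\<bar>prime_error h t\<bar> \<le> K * exp ((1 / 2 + \<delta>) * t)" by (simp add: K_def mult.assoc)
qed

lemma integrable_prime_error:
  assumes bd: "\<And>t. t \<ge> 1 \<Longrightarrow> \<bar>real (primes_pi (exp t)) - expint h t\<bar> \<le> C * (t\<^sup>2 * exp (t / 2))"
    and h: "continuous_on UNIV h" and \<sigma>: "\<sigma> > 1 / 2"
  shows "integrable lborel (\<lambda>t. prime_error h t * exp (- \<sigma> * t))"
proof -
  note [measurable] = borel_measurable_prime_error[OF h]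
  define \<delta> where "\<delta> = (\<sigma> - 1 / 2) / 2"
  have \<delta>: "\<delta> > 0" using \<sigma> by (simp add: \<delta>_def)
  obtain K where K: "K \<ge> 0" "\<And>t. t > 0 \<Longrightarrow> \<bar>prime_error h t\<bar> \<le> K * exp ((1 / 2 + \<delta>) * t)"
    using prime_error_exp_bound[OF bd \<delta>] by blast
  have "has_bochner_integral lborel (\<lambda>t. indicator {0<..} t * (t powr (1 - 1) * exp (- \<delta> * t))) (Gamma 1 * \<delta> powr - 1)"
    by (rule has_bochner_integral_nn_integral) (use nn_integral_powr_exp[OF \<delta>, of 1] \<delta> in auto)
  hence "integrable lborel (\<lambda>t. K * (indicator {0<..} t * (t powr (1 - 1) * exp (- \<delta> * t))))"
    by (simp add: has_bochner_integral_iff)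
  thus ?thesis
  proof (rule Bochner_Integration.integrable_bound)
    show "AE t in lborel. norm (prime_error h t * exp (- \<sigma> * t))
      \<le> norm (K * (indicator {0<..} t * (t powr (1 - 1) * exp (- \<delta> * t))))"
    proof (rule AE_I2)
      fix t :: real
      show "norm (prime_error h t * exp (- \<sigma> * t))
        \<le> norm (K * (indicator {0<..} t * (t powr (1 - 1) * exp (- \<delta> * t))))"
      proof (cases "t > 0")
        case True
        have "\<bar>prime_error h t\<bar> * exp (- \<sigma> * t) \<le> K * exp ((1 / 2 + \<delta>) * t) * exp (- \<sigma> * t)"
          using K(2)[OF True] by (rule mult_right_mono) simp
        also have "\<dots> = K * exp ((1 / 2 + \<delta>) * t + - \<sigma> * t)" by (simp only: exp_add mult.assoc)
        also have "(1 / 2 + \<delta>) * t + - \<sigma> * t = - \<delta> * t" by (simp add: \<delta>_def field_simps)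
        finally show ?thesis using True K by (simp add: abs_mult)
      qed (simp add: prime_error_nonpos)
    qed
  qed measurable
qed

text \<open>Partial summation with indicators: on \<open>{0<..T}\<close> the prime count is the sum
  of the indicators of \<open>{ln p..T}\<close>, and each contributes
  \<open>p powr (- s) - exp (- s * T)\<close>. The part with \<open>expint h\<close> has an explicit
  primitive.\<close>

lemma prime_error_laplace_truncated:
  assumes h: "\<And>x. x \<noteq> 0 \<Longrightarrow> (h has_real_derivative (1 - exp (- x)) / x) (at x)"
    and s: "s > 1" and T: "T \<ge> 1"
  shows "(LINT t|lborel. s * (prime_error h t * exp (- s * t)) * indicator {0..T} t)
     = (\<Sum>p | prime p \<and> real p \<le> exp T. real p powr - s) - prime_error h T * exp (- s * T)
       - (ln T - h ((s - 1) * T)) - h (s - 1)"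
proof -
  define P where "P = {p::nat. prime p \<and> real p \<le> exp T}"
  have finP: "finite P" unfolding P_def by (rule finite_primes_le_real)
  have lnp: "ln (real p) > 0" "ln (real p) \<le> T" "p > 0" if p: "p \<in> P" for p
  proof -
    have p2: "real p \<ge> 2" using p prime_ge_2_nat by (force simp: P_def)
    thus "ln (real p) > 0" "p > 0" by auto
    have "ln (real p) \<le> ln (exp T)" using p p2 unfolding P_def by (subst ln_le_cancel_iff) auto
    thus "ln (real p) \<le> T" by simp
  qed
  have hp: "has_bochner_integral lborel (\<lambda>t. s * exp (- s * t) * indicator {ln (real p)..T} t)
     (real p powr - s - exp (- s * T))" if p: "p \<in> P" for p
  proof -
    have "has_bochner_integral lborel (\<lambda>t. s * exp (- s * t) * indicator {ln (real p)..T} t)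
       (- exp (- s * T) - - exp (- s * ln (real p)))"
      by (rule has_bochner_integral_FTC_Icc_real[OF lnp(2)[OF p]])
         (auto intro!: derivative_eq_intros continuous_intros)
    thus ?thesis using lnp[OF p] by (simp add: powr_def)
  qed
  \<comment> \<open>Integration by parts leaves \<open>exp (- (s - 1) * t) / t\<close>, whose
    primitive is \<open>ln t - h ((s - 1) * t)\<close>. At the lower end \<open>1\<close> this
    yields Ein at \<open>s - 1\<close>.\<close>
  define F where "F t = - (expint h t * exp (- s * t)) + (ln t - h ((s - 1) * t))" for t
  have Ed: "(expint h has_real_derivative exp t / t) (at t)" if "t > 0" for t
    by (rule has_real_derivative_expint[OF h that])
  have Fd: "(F has_real_derivative s * (expint h t * exp (- s * t))) (at t)" if t: "t \<ge> 1" for t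
  proof -
    have t0: "t > 0" using t by simp
    have "(s - 1) * t \<noteq> 0" using s t by simp
    have 1: "((\<lambda>t. h ((s - 1) * t)) has_real_derivative (1 - exp (- ((s - 1) * t))) / ((s - 1) * t) * (s - 1)) (at t)"
      by (rule DERIV_chain2[OF h]) (use s t in \<open>auto intro!: derivative_eq_intros\<close>)
    have 2: "((\<lambda>t. exp (- s * t)) has_real_derivative exp (- s * t) * (- s)) (at t)"
      by (auto intro!: derivative_eq_intros)
    have "(F has_real_derivative - (exp t / t * exp (- s * t) + exp (- s * t) * (- s) * expint h t)
        + (1 / t - (1 - exp (- ((s - 1) * t))) / ((s - 1) * t) * (s - 1))) (at t)"
      unfolding F_def[abs_def]
      by (intro DERIV_add DERIV_minus DERIV_mult DERIV_diff Ed 1 2 DERIV_ln_divide t0)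
    also have "(1 - exp (- ((s - 1) * t))) / ((s - 1) * t) * (s - 1) = (1 - exp (- ((s - 1) * t))) / t"
      using s by simp
    also have "exp (- ((s - 1) * t)) = exp t * exp (- s * t)"
      by (simp add: exp_add[symmetric] algebra_simps)
    finally show ?thesis by (simp add: diff_divide_distrib algebra_simps)
  qed
  have hE: "has_bochner_integral lborel (\<lambda>t. s * (expint h t * exp (- s * t)) * indicator {1..T} t) (F T - F 1)"
  proof (rule has_bochner_integral_FTC_Icc_real[OF T])
    show "isCont (\<lambda>t. s * (expint h t * exp (- s * t))) t" if "1 \<le> t" for t
      using that by (intro continuous_intros DERIV_isCont[OF Ed]) auto
  qed (use Fd in auto)
  have "has_bochner_integral lborel (\<lambda>t. (\<Sum>p\<in>P. s * exp (- s * t) * indicator {ln (real p)..T} t)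
      - s * (expint h t * exp (- s * t)) * indicator {1..T} t)
     ((\<Sum>p\<in>P. real p powr - s - exp (- s * T)) - (F T - F 1))"
    by (intro has_bochner_integral_diff has_bochner_integral_sum hp hE)
  also have "(\<lambda>t. (\<Sum>p\<in>P. s * exp (- s * t) * indicator {ln (real p)..T} t)
      - s * (expint h t * exp (- s * t)) * indicator {1..T} t)
    = (\<lambda>t. s * (prime_error h t * exp (- s * t)) * indicator {0..T} t)"
  proof (rule ext)
    fix t :: real
    show "(\<Sum>p\<in>P. s * exp (- s * t) * indicator {ln (real p)..T} t)
        - s * (expint h t * exp (- s * t)) * indicator {1..T} t
      = s * (prime_error h t * exp (- s * t)) * indicator {0..T} t"
    proof (cases "0 < t \<and> t \<le> T")
      case True
      have "(\<Sum>p\<in>P. indicator {ln (real p)..T} t) = (\<Sum>p\<in>P. if p \<in> {p. real p \<le> exp t} then 1 else 0 :: real)"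
      proof (rule sum.cong)
        fix p assume p: "p \<in> P"
        have "ln (real p) \<le> t \<longleftrightarrow> real p \<le> exp t"
          using lnp(3)[OF p] exp_le_cancel_iff[of "ln (real p)" t] by simp
        thus "indicator {ln (real p)..T} t = (if p \<in> {p. real p \<le> exp t} then 1 else 0 :: real)"
          using True by (simp add: indicator_def)
      qed simp
      also have "\<dots> = real (card (P \<inter> {p. real p \<le> exp t}))"
        by (simp only: sum.inter_restrict[OF finP, symmetric]) simp
      also have "P \<inter> {p. real p \<le> exp t} = {p. prime p \<and> real p \<le> exp t}"
        using True by (auto simp: P_def intro: order_trans)
      finally have "(\<Sum>p\<in>P. indicator {ln (real p)..T} t) = real (primes_pi (exp t))"
        by (simp add: primes_pi_def)
      hence "(\<Sum>p\<in>P. s * exp (- s * t) * indicator {ln (real p)..T} t) = s * exp (- s * t) * real (primes_pi (exp t))"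
        by (simp only: sum_distrib_left[symmetric])
      thus ?thesis using True by (simp add: prime_error_def indicator_def algebra_simps)
    next
      case False
      have "(\<Sum>p\<in>P. s * exp (- s * t) * indicator {ln (real p)..T} t) = 0"
      proof (rule sum.neutral, rule ballI)
        fix p assume p: "p \<in> P"
        have "\<not> (ln (real p) \<le> t \<and> t \<le> T)" using False lnp(1,2)[OF p] by linarith
        thus "s * exp (- s * t) * indicator {ln (real p)..T} t = 0" by simp
      qed
      thus ?thesis using False by (auto simp: indicator_def prime_error_nonpos)
    qed
  qed
  finally have "(LINT t|lborel. s * (prime_error h t * exp (- s * t)) * indicator {0..T} t)
     = (\<Sum>p\<in>P. real p powr - s - exp (- s * T)) - (F T - F 1)"
    by (rule has_bochner_integral_integral_eq)
  also have "(\<Sum>p\<in>P. real p powr - s - exp (- s * T)) = (\<Sum>p\<in>P. real p powr - s) - real (primes_pi (exp T)) * exp (- s * T)"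
    by (simp add: sum_subtractf P_def primes_pi_def)
  also have "F 1 = - h (s - 1)" by (simp add: F_def expint_def)
  finally show ?thesis
    using T by (simp add: F_def P_def prime_error_def algebra_simps)
qed

text \<open>Writing \<open>ln T\<close> as \<open>ln ((s - 1) * T) - ln (s - 1)\<close> lets the
  limit \<open>c\<close> apply as \<open>T\<close> grows. The leftover \<open>- ln (s - 1)\<close>
  is the logarithmic singularity belonging to the pole of zeta.\<close>

lemma prime_sum_tendsto:
  assumes h: "\<And>x. x \<noteq> 0 \<Longrightarrow> (h has_real_derivative (1 - exp (- x)) / x) (at x)"
    and cont: "continuous_on UNIV h"
    and c: "((\<lambda>x. ln x - h x) \<longlongrightarrow> c) at_top"
    and bd: "\<And>t. t \<ge> 1 \<Longrightarrow> \<bar>real (primes_pi (exp t)) - expint h t\<bar> \<le> C * (t\<^sup>2 * exp (t / 2))"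
    and s: "s > 1"
  shows "(\<lambda>N. \<Sum>p | prime p \<and> p < N. real p powr - s)
     \<longlonglongrightarrow> s * (LINT t|lborel. prime_error h t * exp (- s * t)) + c - ln (s - 1) + h (s - 1)"
proof -
  note [measurable] = borel_measurable_prime_error[OF cont]
  define I where "I T = (LINT t|lborel. s * (prime_error h t * exp (- s * t)) * indicator {0..T} t)" for T
  have int: "integrable lborel (\<lambda>t. prime_error h t * exp (- s * t))"
    using s by (intro integrable_prime_error[OF bd cont]) auto
  have "(I \<longlongrightarrow> (LINT t|lborel. s * (prime_error h t * exp (- s * t)))) at_top"
    unfolding I_def[abs_def]
  proof (rule integral_dominated_convergence_at_top)
    show "integrable lborel (\<lambda>t. norm (s * (prime_error h t * exp (- s * t))))"
      by (intro integrable_norm integrable_mult_right int)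
    show "AE t in lborel. ((\<lambda>T. s * (prime_error h t * exp (- s * t)) * indicator {0..T} t)
        \<longlongrightarrow> s * (prime_error h t * exp (- s * t))) at_top"
    proof (rule AE_I2, rule tendsto_eventually)
      fix t :: real
      show "\<forall>\<^sub>F T in at_top. s * (prime_error h t * exp (- s * t)) * indicator {0..T} t
          = s * (prime_error h t * exp (- s * t))"
        using eventually_ge_at_top[of t]
        by eventually_elim (cases "t \<le> 0", auto simp: prime_error_nonpos)
    qed
    show "\<forall>\<^sub>F T in at_top. AE t in lborel. norm (s * (prime_error h t * exp (- s * t)) * indicator {0..T} t)
        \<le> norm (s * (prime_error h t * exp (- s * t)))"
      by (intro always_eventually allI AE_I2) (auto simp: indicator_def)
  qed measurable
  hence limI: "(I \<longlongrightarrow> s * (LINT t|lborel. prime_error h t * exp (- s * t))) at_top" by simp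
  have "filterlim (\<lambda>T. (s - 1) * T) at_top at_top"
    using s by (intro filterlim_tendsto_pos_mult_at_top[OF tendsto_const]) (auto simp: filterlim_ident)
  from filterlim_compose[OF c this]
  have limc: "((\<lambda>T. ln ((s - 1) * T) - h ((s - 1) * T)) \<longlongrightarrow> c) at_top" .
  \<comment> \<open>This choice makes the bound a multiple of \<open>exp t\<close>, which
    \<open>exp (- s * t)\<close> beats since \<open>s > 1\<close>.\<close>
  obtain K where K: "K \<ge> 0" "\<And>t. t > 0 \<Longrightarrow> \<bar>prime_error h t\<bar> \<le> K * exp ((1 / 2 + 1 / 2) * t)"
    using prime_error_exp_bound[OF bd, of "1 / 2"] by auto
  have lime: "((\<lambda>T. prime_error h T * exp (- s * T)) \<longlongrightarrow> 0) at_top"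
  proof (rule Lim_null_comparison)
    show "\<forall>\<^sub>F T in at_top. norm (prime_error h T * exp (- s * T)) \<le> K * exp (- ((s - 1) * T))"
      using eventually_gt_at_top[of 0]
    proof eventually_elim
      case (elim T)
      have "norm (prime_error h T * exp (- s * T)) = \<bar>prime_error h T\<bar> * exp (- s * T)"
        by (simp add: abs_mult)
      also have "\<dots> \<le> K * exp ((1 / 2 + 1 / 2) * T) * exp (- s * T)"
        using K(2)[OF elim] by (rule mult_right_mono) simp
      also have "\<dots> = K * exp ((1 / 2 + 1 / 2) * T + - s * T)" by (simp only: exp_add mult.assoc)
      also have "(1 / 2 + 1 / 2) * T + - s * T = - ((s - 1) * T)" by (simp add: algebra_simps)
      finally show ?case .
    qed
    have "((\<lambda>T. exp (- ((s - 1) * T))) \<longlongrightarrow> 0) at_top"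
      using \<open>filterlim (\<lambda>T. (s - 1) * T) at_top at_top\<close>
      by (intro filterlim_compose[OF exp_at_bot]) (simp add: filterlim_uminus_at_bot)
    from tendsto_mult[OF tendsto_const this] show "((\<lambda>T. K * exp (- ((s - 1) * T))) \<longlongrightarrow> 0) at_top"
      by simp
  qed
  have lim: "((\<lambda>T. I T + prime_error h T * exp (- s * T) + (ln ((s - 1) * T) - h ((s - 1) * T)) - ln (s - 1) + h (s - 1))
     \<longlongrightarrow> s * (LINT t|lborel. prime_error h t * exp (- s * t)) + 0 + c - ln (s - 1) + h (s - 1)) at_top"
    by (intro tendsto_add tendsto_diff tendsto_const limI limc lime)
  \<comment> \<open>Sampling at \<open>T = ln N\<close> turns \<open>real p \<le> exp T\<close> into
    \<open>p < Suc N\<close>.\<close>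
  have "filterlim (\<lambda>N. ln (real N)) at_top sequentially"
    by (rule filterlim_compose[OF ln_at_top filterlim_real_sequentially])
  note lim = filterlim_compose[OF lim this]
  have "\<forall>\<^sub>F N in sequentially. ln (real N) \<ge> 1"
    using \<open>filterlim (\<lambda>N. ln (real N)) at_top sequentially\<close> by (simp add: filterlim_at_top)
  hence ev: "\<forall>\<^sub>F N in sequentially. I (ln (real N)) + prime_error h (ln (real N)) * exp (- s * ln (real N))
      + (ln ((s - 1) * ln (real N)) - h ((s - 1) * ln (real N))) - ln (s - 1) + h (s - 1)
      = (\<Sum>p | prime p \<and> p < Suc N. real p powr - s)"
  proof eventually_elim
    case (elim N)
    define T where "T = ln (real N)"
    have T: "T \<ge> 1" using elim by (simp add: T_def)
    hence "N > 0" by (intro Nat.gr0I) (simp add: T_def)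
    hence "exp T = real N" by (simp add: T_def)
    hence P: "{p. prime p \<and> p < Suc N} = {p. prime p \<and> real p \<le> exp T}" by auto
    have "ln ((s - 1) * T) = ln (s - 1) + ln T" using s T by (intro ln_mult_pos) auto
    moreover have "I T = (\<Sum>p | prime p \<and> real p \<le> exp T. real p powr - s)
        - prime_error h T * exp (- s * T) - (ln T - h ((s - 1) * T)) - h (s - 1)"
      unfolding I_def by (rule prime_error_laplace_truncated[OF h s T])
    ultimately show ?case unfolding T_def[symmetric] P by simp
  qed
  have "(\<lambda>N. \<Sum>p | prime p \<and> p < Suc N. real p powr - s)
     \<longlonglongrightarrow> s * (LINT t|lborel. prime_error h t * exp (- s * t)) + 0 + c - ln (s - 1) + h (s - 1)"
    by (rule Lim_transform_eventually[OF lim ev])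
  from LIMSEQ_imp_Suc[where f = "\<lambda>N. \<Sum>p | prime p \<and> p < N. real p powr - s", OF this]
  show ?thesis by simp
qed

text \<open>Multiplication by \<open>s - 1\<close> absorbs the \<open>- ln (s - 1)\<close> in the
  exponent, so \<open>K\<close> is holomorphic across \<open>1\<close> and the continued identity
  contains no logarithm. A product equal to an exponential has no vanishing factor.\<close>

lemma riemann_zeta_nonzero_right:
  assumes H: "H holomorphic_on UNIV" "\<And>x. H (of_real x) = of_real (h x)"
    and h: "\<And>x. x \<noteq> 0 \<Longrightarrow> (h has_real_derivative (1 - exp (- x)) / x) (at x)"
    and cont: "continuous_on UNIV h"
    and bd: "\<And>t. t \<ge> 1 \<Longrightarrow> \<bar>real (primes_pi (exp t)) - expint h t\<bar> \<le> C * (t\<^sup>2 * exp (t / 2))"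
    and s: "Re s > 1 / 2" "s \<noteq> 1"
  shows "riemann_zeta s \<noteq> 0"
proof -
  note [measurable] = borel_measurable_prime_error[OF cont]
  obtain c where c: "((\<lambda>x. ln x - h x) \<longlongrightarrow> c) at_top"
    using ln_minus_ein_tendsto[OF h] by blast
  obtain W where W: "W holomorphic_on {s. Re s > 1 / 2}"
    "\<And>s. Re s > 1 / 2 \<Longrightarrow>
      (\<lambda>N. \<Prod>n<N. weierstrass_factor 1 (if prime n then exp (- s * of_real (ln (real n))) else 0)) \<longlonglongrightarrow> W s"
    using prime_weierstrass_product by blast
  define L :: "complex \<Rightarrow> complex" where "L s = (\<integral>t. of_real (prime_error h t) * exp (s * of_real (- t)) \<partial>lborel)" for s
  have "L holomorphic_on {s. Re s \<in> {1 / 2<..}}"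
    unfolding L_def[abs_def]
  proof (rule holomorphic_on_exp_transform)
    fix \<sigma> :: real assume "\<sigma> \<in> {1 / 2<..}"
    hence "integrable lborel (\<lambda>t. norm (prime_error h t * exp (- \<sigma> * t)))"
      by (intro integrable_norm integrable_prime_error[OF bd cont]) auto
    thus "integrable lborel (\<lambda>t. norm (complex_of_real (prime_error h t)) * exp (\<sigma> * - t))"
      by (simp add: abs_mult)
  qed (simp, measurable)
  hence L: "L holomorphic_on {s. Re s > 1 / 2}" by simp
  define K where "K s = s * L s + of_real c + H (s - 1)" for s
  have "(H \<circ> (\<lambda>s. s - 1)) holomorphic_on {s. Re s > 1 / 2}"
    by (rule holomorphic_on_compose_gen[OF _ H(1)]) (auto intro!: holomorphic_intros)
  hence K: "K holomorphic_on {s. Re s > 1 / 2}"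
    unfolding K_def[abs_def] o_def by (intro holomorphic_intros L)
  have "(s - 1) * riemann_zeta s * W s = exp (K s)"
  proof (rule analytic_continuation_real_interval[where f = "\<lambda>s. (s - 1) * riemann_zeta s * W s"
        and g = "\<lambda>s. exp (K s)" and S = "{s. Re s > 1 / 2} - {1}" and a = 1 and b = 2])
    show "(\<lambda>s. (s - 1) * riemann_zeta s * W s) holomorphic_on {s. Re s > 1 / 2} - {1}"
      by (intro holomorphic_intros holomorphic_on_subset[OF holomorphic_riemann_zeta] holomorphic_on_subset[OF W(1)]) auto
    show "(\<lambda>s. exp (K s)) holomorphic_on {s. Re s > 1 / 2} - {1}"
      by (intro holomorphic_intros holomorphic_on_subset[OF K]) auto
    show "open ({s. Re s > 1 / 2} - {1})" by (intro open_delete open_Re_gt)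
    show "connected ({s. Re s > 1 / 2} - {1})"
      by (intro connected_open_delete open_Re_gt convex_connected convex_halfspace_Re_gt) simp
    fix x :: real assume x: "1 < x" "x < 2"
    show "of_real x \<in> {s. Re s > 1 / 2} - {1}" using x by auto
    define r where "r = (LINT t|lborel. prime_error h t * exp (- x * t))"
    have "L (of_real x) = of_real r"
    proof -
      have "complex_of_real (prime_error h t) * exp (of_real x * of_real (- t))
          = of_real (prime_error h t * exp (- x * t))" for t
        by (simp flip: exp_of_real)
      thus ?thesis unfolding L_def r_def by (simp only: integral_complex_of_real)
    qed
    hence Kx: "K (of_real x) = of_real (x * r + c + h (x - 1))"
      using H(2)[of "x - 1"] by (simp add: K_def)
    have "riemann_zeta (of_real x) * W (of_real x) = of_real (exp (x * r + c - ln (x - 1) + h (x - 1)))"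
      unfolding r_def
    proof (rule zeta_times_weierstrass_product[OF x(1)])
      show "(\<lambda>N. \<Prod>n<N. weierstrass_factor 1 (if prime n then exp (- of_real x * of_real (ln (real n))) else 0))
         \<longlonglongrightarrow> W (of_real x)" by (rule W(2)) (use x in simp)
    qed (rule prime_sum_tendsto[OF h cont c bd x(1)])
    moreover have "(x - 1) * exp (x * r + c - ln (x - 1) + h (x - 1)) = exp (x * r + c + h (x - 1))"
    proof -
      have "x * r + c + h (x - 1) = ln (x - 1) + (x * r + c - ln (x - 1) + h (x - 1))" by simp
      hence "exp (x * r + c + h (x - 1)) = exp (ln (x - 1)) * exp (x * r + c - ln (x - 1) + h (x - 1))"
        by (simp only: exp_add)
      thus ?thesis using x by simp
    qed
    ultimately show "(of_real x - 1) * riemann_zeta (of_real x) * W (of_real x) = exp (K (of_real x))"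
      unfolding Kx by (metis (no_types, lifting) exp_of_real mult.assoc of_real_1 of_real_diff of_real_mult)
  qed (use s in auto)
  thus ?thesis by (metis exp_not_eq_zero mult_zero_left mult_zero_right)
qed

theorem theorem2p29:
  fixes \<kappa>\<^sub>l \<kappa>\<^sub>u :: real
  assumes "0 < \<kappa>\<^sub>l" and "\<kappa>\<^sub>l < \<kappa>\<^sub>u" and "\<kappa>\<^sub>u < exp 1"
    and "\<kappa>\<^sub>l * (1 - ln \<kappa>\<^sub>l) = 1 / 2"
    and "\<kappa>\<^sub>u * (1 - ln \<kappa>\<^sub>u) = 1 / 2"
    and "\<forall>x \<ge> exp 1. li0 \<kappa>\<^sub>l x \<le> real (primes_pi x) \<and> real (primes_pi x) \<le> li1 \<kappa>\<^sub>u x"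
  shows "riemann_hypothesis"
proof -
  obtain H :: "complex \<Rightarrow> complex" and h :: "real \<Rightarrow> real"
    where H: "H holomorphic_on UNIV" "\<And>x. H (of_real x) = of_real (h x)"
      and h: "\<And>x. x \<noteq> 0 \<Longrightarrow> (h has_real_derivative (1 - exp (- x)) / x) (at x)"
      and cont: "continuous_on UNIV h"
    using entire_exponential_integral by blast
  have E: "(expint h has_real_derivative exp t / t) (at t)" if "t > 0" for t
    by (rule has_real_derivative_expint[OF h that])
  \<comment> \<open>Both expansions are compared with the same antiderivative
    \<open>expint h\<close>, so the two one-sided bounds enclose the prime count around a single
    function.\<close>
  obtain C1 where C1: "\<And>t. t \<ge> 1 \<Longrightarrow> \<bar>expint h t - li0 \<kappa>\<^sub>l (exp t)\<bar> \<le> C1 * (t\<^sup>2 * exp (t / 2))"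
    by (rule li_partial_sum_bound[OF E assms(1,4)]) (assumption, rule that, blast)
  have \<kappa>\<^sub>u: "0 < \<kappa>\<^sub>u" using assms(1,2) by simp
  obtain C2 where C2: "\<And>t. t \<ge> 1 \<Longrightarrow> \<bar>expint h t - li1 \<kappa>\<^sub>u (exp t)\<bar> \<le> C2 * (t\<^sup>2 * exp (t / 2))"
    by (rule li_partial_sum_bound[OF E \<kappa>\<^sub>u assms(5)]) (assumption, rule that, blast)
  have bd: "\<bar>real (primes_pi (exp t)) - expint h t\<bar> \<le> max C1 C2 * (t\<^sup>2 * exp (t / 2))" if t: "t \<ge> 1" for t
  proof -
    have "li0 \<kappa>\<^sub>l (exp t) \<le> real (primes_pi (exp t))" "real (primes_pi (exp t)) \<le> li1 \<kappa>\<^sub>u (exp t)"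
      using assms(6) t by simp_all
    moreover have "C1 * (t\<^sup>2 * exp (t / 2)) \<le> max C1 C2 * (t\<^sup>2 * exp (t / 2))"
      "C2 * (t\<^sup>2 * exp (t / 2)) \<le> max C1 C2 * (t\<^sup>2 * exp (t / 2))"
      by (intro mult_right_mono; simp)+
    ultimately show ?thesis using C1[OF t] C2[OF t] by linarith
  qed
  have nz: "riemann_zeta s \<noteq> 0" if "Re s > 1 / 2" "s \<noteq> 1" for s
    by (rule riemann_zeta_nonzero_right[OF H h cont bd that])
  show ?thesis unfolding riemann_hypothesis_def
  proof (intro allI impI)
    fix s assume s: "s \<noteq> 1 \<and> riemann_zeta s = 0 \<and> (\<nexists>n::nat. n \<ge> 1 \<and> s = - 2 * of_nat n)"
    have "\<not> Re s > 1 / 2" using nz s by blast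
    moreover have "\<not> Re s < 1 / 2" using riemann_zeta_zero_Re_less_half[OF nz] s by blast
    ultimately show "Re s = 1 / 2" by linarith
  qed
qed

end
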